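(* Let $d,a,b_1,\dots,b_n,c_1,\dots,c_n$ be positive integers with $d\mid q-1$, let $\lambda_1,\dots,\lambda_n\in\kappa^\times$, and let $S^1_{A,\lambda}$, $S^2_{A,\lambda}$ be the $n$-dimensional affine hypersurfaces over $\kappa$ defined by $$S^1_{A,\lambda}:\ y^d=\Big(1-\sum_{i=1}^n\lambda_ix_i\Big)^a\prod_{i=1}^nx_i^{b_i}(1-x_i)^{c_i},\qquad S^2_{A,\lambda}:\ y^d=\Big(\prod_{i=1}^n(x_i-\lambda_i)^{b_i}\Big)\Big(\prod_{i=1}^nx_i^{c_i}\Big)\Big(1-\sum_{i=1}^nx_i\Big)^a,$$ with $\mu_d$ acting by $\xi\cdot(x_1,\dots,x_n,y)=(x_1,\dots,x_n,\xi y)$. Let $m\in\mathbb{Z}/d\mathbb{Z}$. (i) Suppose that $\gcd(d,a)=\gcd(d,c_i)=1$ for all $i$. Then $$N_1(S^1_{A,\lambda};\chi^m)=\begin{cases}q^n&(m=0),\\ \Big(\prod_{i=1}^n\big(-j(\varphi_d^{mb_i},\varphi_d^{mc_i})\big)\Big)F_A^{(n)}\left({\overline{\varphi_d}^{ma};\varphi_d^{mb_1},\dots,\varphi_d^{mb_n}\atop\varphi_d^{m(b_1+c_1)},\dots,\varphi_d^{m(b_n+c_n)}};\lambda_1,\dots,\lambda_n\right)&(m\neq0).\end{cases}$$ (ii) Suppose that $\gcd(d,a)=\gcd(d,b_i)=1$ for all $i$. Then $$N_1(S^2_{A,\lambda};\chi^m)=\begin{cases}q^n&(m=0),\\ (-1)^nJ_A\cdot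 F_A^{(n)}\left({\overline{\varphi_d}^{m(a+\sum_{i=1}^n(b_i+c_i))};\overline{\varphi_d}^{mb_1},\dots,\overline{\varphi_d}^{mb_n}\atop\overline{\varphi_d}^{m(b_1+c_1)},\dots,\overline{\varphi_d}^{m(b_n+c_n)}};\lambda_1,\dots,\lambda_n\right)&(m\neq0),\end{cases}$$ where $J_A=j\big(\varphi_d^{ma},\varphi_d^{m(b_1+c_1)},\dots,\varphi_d^{m(b_n+c_n)}\big)$.
   Context: $\kappa$ is a finite field with $q$ elements of characteristic $p$. $\widehat{\kappa^\times}=\mathrm{Hom}(\kappa^\times,\overline{\mathbb{Q}}^\times)$ is the group of multiplicative characters, $\varepsilon$ the trivial character, $\overline{\eta}=\eta^{-1}$; every $\eta\in\widehat{\kappa^\times}$ (including $\varepsilon$) is extended to $\kappa$ by $\eta(0)=0$. $\delta(\eta)=1$ if $\eta=\varepsilon$ and $0$ otherwise. Fix a non-trivial additive character $\psi\in\mathrm{Hom}(\kappa,\overline{\mathbb{Q}}^\times)$. Put $$g(\eta)=-\sum_{x\in\kappa^\times}\psi(x)\eta(x),\quad g^\circ(\eta)=q^{\delta(\eta)}g(\eta),\quad j(\eta_1,\dots,\eta_k)=(-1)^{k-1}\sum_{x_i\in\kappa^\times,\ x_1+\cdots+x_k=1}\ \prod_{i=1}^k\eta_i(x_i)\ (k\ge 2),$$ $$(\alpha)_\nu=\frac{g(\alpha\nu)}{g(\alpha)},\qquad(\alpha)_\nu^\circ=\frac{g^\circ(\alpha\nu)}{g^\circ(\alpha)},$$ $$F_A^{(n)}\left({\alpha;\beta_1,\dots,\beta_n\atop\gamma_1,\dots,\gamma_n};\lambda_1,\dots,\lambda_n\right)=\frac{1}{(1-q)^n}\sum_{\nu_1,\dots,\nu_n\in\widehat{\kappa^\times}}\frac{(\alpha)_{\nu_1\cdots\nu_n}(\beta_1)_{\nu_1}\cdots(\beta_n)_{\nu_n}}{(\gamma_1)^\circ_{\nu_1}\cdots(\gamma_n)^\circ_{\nu_n}(\varepsilon)^\circ_{\nu_1}\cdots(\varepsilon)^\circ_{\nu_n}}\nu_1(\lambda_1)\cdots\nu_n(\lambda_n).$$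 $\mu_d\subset\kappa^\times$ is the group of $d$th roots of unity. Fix a generator $\varphi$ of $\widehat{\kappa^\times}$ and put $\varphi_d=\varphi^{(q-1)/d}$, $\chi=\varphi|_{\mu_d}$, so that $\widehat{\mu_d}=\{\chi^m\mid m\in\mathbb{Z}/d\mathbb{Z}\}$. For a variety $V$ over $\kappa$ with an action over $\kappa$ of a finite abelian group $G$, with $F$ the $q$-Frobenius on $V(\overline{\kappa})$, and for $\theta\in\mathrm{Hom}(G,\overline{\mathbb{Q}}^\times)$ and $r\ge1$, $$N_r(V;\theta)=\frac{1}{\#G}\sum_{g\in G}\theta(g)\,\#\{x\in V(\overline{\kappa})\mid F^r(x)=g(x)\}.$$ *)

theory Defs
  imports
    "HOL-Algebra.Algebra"
    "HOL-Algebra.Algebraic_Closure_Type"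
    "HOL-Library.Cardinality"
begin

text \<open>The finite field \<open>\<kappa>\<close> is a type \<open>'k :: {field, finite}\<close>, so \<open>q = CARD('k)\<close>, and its algebraic
  closure is \<open>'k alg_closure\<close>.\<close>

type_synonym qbar = "rat alg_closure"

section \<open>Characters\<close>

text \<open>Characters of \<open>\<kappa>\<^sup>\<times>\<close>, each extended to \<open>\<kappa>\<close> by \<open>0\<close> at \<open>0\<close>; this also applies to the
  trivial one, which is the unit of \<open>char_group\<close>.\<close>

definition mult_chars :: "('k::{field,finite} \<Rightarrow> qbar) set" where
  "mult_chars = {\<eta> \<in> hom (mult_of (ring_of_type_algebra :: 'k ring))
                         (mult_of (ring_of_type_algebra :: qbar ring)). \<eta> 0 = 0}"

definition char_group :: "('k::{field,finite} \<Rightarrow> qbar) monoid" where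
  "char_group = \<lparr>carrier = mult_chars,
                 monoid.mult = (\<lambda>\<alpha> \<beta> x. \<alpha> x * \<beta> x),
                 one = (\<lambda>x. if x = 0 then 0 else 1)\<rparr>"

definition add_chars :: "('k::{field,finite} \<Rightarrow> qbar) set" where
  "add_chars = hom (add_monoid (ring_of_type_algebra :: 'k ring))
                   (mult_of (ring_of_type_algebra :: qbar ring))"

definition nontrivial_add_char :: "('k::{field,finite} \<Rightarrow> qbar) \<Rightarrow> bool" where
  "nontrivial_add_char \<psi> \<longleftrightarrow> \<psi> \<in> add_chars \<and> \<psi> \<noteq> (\<lambda>_. 1)"

definition generates_chars :: "('k::{field,finite} \<Rightarrow> qbar) \<Rightarrow> bool" where
  "generates_chars \<phi> \<longleftrightarrow> \<phi> \<in> carrier char_group \<and> generate char_group {\<phi>} = carrier char_group"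

definition char_part :: "('k::{field,finite} \<Rightarrow> qbar) \<Rightarrow> nat \<Rightarrow> ('k \<Rightarrow> qbar)" where
  "char_part \<phi> d = \<phi> [^]\<^bsub>char_group\<^esub> ((CARD('k) - 1) div d)"

lemma mult_chars_iff:
  "\<eta> \<in> mult_chars \<longleftrightarrow>
     \<eta> 0 = 0 \<and> (\<forall>x. x \<noteq> 0 \<longrightarrow> \<eta> x \<noteq> 0) \<and> (\<forall>x y. x \<noteq> 0 \<longrightarrow> y \<noteq> 0 \<longrightarrow> \<eta> (x * y) = \<eta> x * \<eta> y)"
  by (auto simp: mult_chars_def hom_def ring_of_type_algebra_def)

lemma add_chars_iff:
  "\<psi> \<in> add_chars \<longleftrightarrow> (\<forall>x. \<psi> x \<noteq> 0) \<and> (\<forall>x y. \<psi> (x + y) = \<psi> x * \<psi> y)"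
  by (auto simp: add_chars_def hom_def ring_of_type_algebra_def)

lemma comm_group_char_group: "comm_group (char_group :: ('k::{field,finite} \<Rightarrow> qbar) monoid)"
proof (rule comm_groupI)
  fix \<eta> :: "'k \<Rightarrow> qbar"
  assume \<eta>: "\<eta> \<in> carrier char_group"
  show "\<exists>\<theta> \<in> carrier char_group. \<theta> \<otimes>\<^bsub>char_group\<^esub> \<eta> = \<one>\<^bsub>char_group\<^esub>"
    using \<eta> by (intro bexI[of _ "\<lambda>x. inverse (\<eta> x)"])
      (auto simp: char_group_def mult_chars_iff fun_eq_iff)
qed (auto simp: char_group_def mult_chars_iff fun_eq_iff)

section \<open>Gauss sums, Jacobi sums and hypergeometric functions\<close>

definition gauss :: "('k::{field,finite} \<Rightarrow> qbar) \<Rightarrow> ('k \<Rightarrow> qbar) \<Rightarrow> qbar" where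
  "gauss \<psi> \<eta> = - (\<Sum>x | x \<noteq> 0. \<psi> x * \<eta> x)"

definition char_delta :: "('k::{field,finite} \<Rightarrow> qbar) \<Rightarrow> nat" where
  "char_delta \<eta> = (if \<eta> = \<one>\<^bsub>char_group\<^esub> then 1 else 0)"

definition gauss_circ :: "('k::{field,finite} \<Rightarrow> qbar) \<Rightarrow> ('k \<Rightarrow> qbar) \<Rightarrow> qbar" where
  "gauss_circ \<psi> \<eta> = of_nat CARD('k) ^ char_delta \<eta> * gauss \<psi> \<eta>"

definition jacobi :: "('k::{field,finite} \<Rightarrow> qbar) list \<Rightarrow> qbar" where
  "jacobi \<eta>s = (-1) ^ (length \<eta>s - 1) *
     (\<Sum>xs | length xs = length \<eta>s \<and> 0 \<notin> set xs \<and> sum_list xs = 1.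
        \<Prod>i<length \<eta>s. (\<eta>s ! i) (xs ! i))"

definition poch :: "('k::{field,finite} \<Rightarrow> qbar) \<Rightarrow> ('k \<Rightarrow> qbar) \<Rightarrow> ('k \<Rightarrow> qbar) \<Rightarrow> qbar" where
  "poch \<psi> \<alpha> \<nu> = gauss \<psi> (\<alpha> \<otimes>\<^bsub>char_group\<^esub> \<nu>) / gauss \<psi> \<alpha>"

definition poch_circ :: "('k::{field,finite} \<Rightarrow> qbar) \<Rightarrow> ('k \<Rightarrow> qbar) \<Rightarrow> ('k \<Rightarrow> qbar) \<Rightarrow> qbar" where
  "poch_circ \<psi> \<alpha> \<nu> = gauss_circ \<psi> (\<alpha> \<otimes>\<^bsub>char_group\<^esub> \<nu>) / gauss_circ \<psi> \<alpha>"

text \<open>Families indexed by \<open>1, \<dots>, n\<close> are functions on \<open>nat\<close> of which only the values on \<open>{1..n}\<close>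
  are used.\<close>

definition lauricella_A ::
  "('k::{field,finite} \<Rightarrow> qbar) \<Rightarrow> nat \<Rightarrow> ('k \<Rightarrow> qbar) \<Rightarrow> (nat \<Rightarrow> 'k \<Rightarrow> qbar) \<Rightarrow> (nat \<Rightarrow> 'k \<Rightarrow> qbar)
     \<Rightarrow> (nat \<Rightarrow> 'k) \<Rightarrow> qbar" where
  "lauricella_A \<psi> n \<alpha> \<beta> \<gamma> l =
     1 / (1 - of_nat CARD('k)) ^ n *
     (\<Sum>\<nu> \<in> {1..n} \<rightarrow>\<^sub>E carrier char_group.
        poch \<psi> \<alpha> (\<Otimes>\<^bsub>char_group\<^esub>i\<in>{1..n}. \<nu> i) * (\<Prod>i\<in>{1..n}. poch \<psi> (\<beta> i) (\<nu> i)) /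
        ((\<Prod>i\<in>{1..n}. poch_circ \<psi> (\<gamma> i) (\<nu> i)) *
         (\<Prod>i\<in>{1..n}. poch_circ \<psi> \<one>\<^bsub>char_group\<^esub> (\<nu> i))) *
        (\<Prod>i\<in>{1..n}. \<nu> i (l i)))"

section \<open>Counting points with a character\<close>

text \<open>\<open>V\<close> is the set of geometric points, \<open>F\<close> the \<open>q\<close>-Frobenius on them, and \<open>act\<close> the action of
  the finite abelian group \<open>G\<close>.\<close>

definition point_count ::
  "'x set \<Rightarrow> ('x \<Rightarrow> 'x) \<Rightarrow> 'g monoid \<Rightarrow> ('g \<Rightarrow> 'x \<Rightarrow> 'x) \<Rightarrow> nat \<Rightarrow> ('g \<Rightarrow> qbar) \<Rightarrow> qbar" where
  "point_count V F G act r \<theta> =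
     1 / of_nat (card (carrier G)) *
     (\<Sum>g\<in>carrier G. \<theta> g * of_nat (card {x \<in> V. (F ^^ r) x = act g x}))"

definition roots_of_unity :: "nat \<Rightarrow> 'k::{field,finite} monoid" where
  "roots_of_unity d = \<lparr>carrier = {\<xi>. \<xi> ^ d = 1}, monoid.mult = (*), one = 1\<rparr>"

definition mu_char :: "('k::{field,finite} \<Rightarrow> qbar) \<Rightarrow> nat \<Rightarrow> ('k \<Rightarrow> qbar)" where
  "mu_char \<phi> d = restrict \<phi> (carrier (roots_of_unity d))"

definition mu_char_power :: "('k::{field,finite} \<Rightarrow> qbar) \<Rightarrow> nat \<Rightarrow> int \<Rightarrow> ('k \<Rightarrow> qbar)" where
  "mu_char_power \<phi> d m = (\<lambda>\<xi>\<in>carrier (roots_of_unity d). mu_char \<phi> d \<xi> powi m)"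

section \<open>The affine hypersurfaces\<close>

text \<open>A geometric point of affine \<open>(n+1)\<close>-space is a pair \<open>(x, y)\<close>, with \<open>x\<close> an extensional
  function on \<open>{1..n}\<close>, so that distinct pairs are distinct points.\<close>

type_synonym 'k point = "(nat \<Rightarrow> 'k alg_closure) \<times> 'k alg_closure"

definition frob :: "nat \<Rightarrow> 'k::{field,finite} point \<Rightarrow> 'k point" where
  "frob n = (\<lambda>(x, y). (\<lambda>i\<in>{1..n}. x i ^ CARD('k), y ^ CARD('k)))"

definition mu_act :: "'k::{field,finite} \<Rightarrow> 'k point \<Rightarrow> 'k point" where
  "mu_act \<xi> = (\<lambda>(x, y). (x, to_ac \<xi> * y))"

definition S1_A ::
  "nat \<Rightarrow> nat \<Rightarrow> nat \<Rightarrow> (nat \<Rightarrow> nat) \<Rightarrow> (nat \<Rightarrow> nat) \<Rightarrow> (nat \<Rightarrow> 'k::{field,finite}) \<Rightarrow> 'k point set" where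
  "S1_A n d a b c l =
     {(x, y). x \<in> {1..n} \<rightarrow>\<^sub>E UNIV \<and>
        y ^ d = (1 - (\<Sum>i\<in>{1..n}. to_ac (l i) * x i)) ^ a *
                (\<Prod>i\<in>{1..n}. x i ^ b i * (1 - x i) ^ c i)}"

definition S2_A ::
  "nat \<Rightarrow> nat \<Rightarrow> nat \<Rightarrow> (nat \<Rightarrow> nat) \<Rightarrow> (nat \<Rightarrow> nat) \<Rightarrow> (nat \<Rightarrow> 'k::{field,finite}) \<Rightarrow> 'k point set" where
  "S2_A n d a b c l =
     {(x, y). x \<in> {1..n} \<rightarrow>\<^sub>E UNIV \<and>
        y ^ d = (\<Prod>i\<in>{1..n}. (x i - to_ac (l i)) ^ b i) * (\<Prod>i\<in>{1..n}. x i ^ c i) *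
                (1 - (\<Sum>i\<in>{1..n}. x i)) ^ a}"

text \<open>\<open>N\<^sub>r(V; \<theta>)\<close> for a variety \<open>V\<close> in affine \<open>(n+1)\<close>-space that is stable under \<open>\<mu>\<^sub>d\<close>.\<close>

definition mu_count ::
  "nat \<Rightarrow> nat \<Rightarrow> nat \<Rightarrow> 'k::{field,finite} point set \<Rightarrow> ('k \<Rightarrow> qbar) \<Rightarrow> qbar" where
  "mu_count n d r V \<theta> = point_count V (frob n) (roots_of_unity d) mu_act r \<theta>"

end

theory Submission
  imports Defs
begin

text \<open>
  Write \<open>q\<close> for the number of elements of \<open>\<kappa>\<close> and \<open>\<eta> = \<phi>\<^sub>d\<^sup>m\<close>.  Both hypersurfaces have an equation
  \<open>y\<^sup>d = f(x)\<close>, so a twisted fixed point \<open>F(x, y) = (x, \<xi>y)\<close> has \<open>x\<close> rational, and over such an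
  \<open>x\<close> with \<open>f(x) \<noteq> 0\<close> there are \<open>d\<close> such points if \<open>\<xi>\<close> is the \<open>((q-1)/d)\<close>-th power of \<open>f(x)\<close> and
  none otherwise.  Averaging against \<open>\<chi>\<^sup>m\<close> turns the count into the character sum \<open>\<Sum>\<^sub>x \<eta>(f(x))\<close>, to
  which the zeros of \<open>f\<close> contribute only if \<open>d\<close> divides \<open>m\<close>; in that case the total is \<open>q\<^sup>n\<close>
  (\<open>mu_count_cyclic_cover\<close>).  What remains are two finite-field analogues of integral
  representations of the Lauricella function.

  The analytic input is the Fourier expansion of \<open>\<psi>\<close> in multiplicative characters
  (\<open>psi_mellin\<close>), which rests on the orthogonality relation \<open>sum_mult_chars\<close>, together with the
  fact that for a nontrivial \<open>\<alpha>\<close> the function \<open>y \<mapsto> \<alpha>\<^sup>-\<^sup>1(y)\<close> is, up to a Gauss sum, the additive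
  Fourier transform of \<open>\<alpha>\<close>, even at \<open>y = 0\<close> (\<open>gauss_twist\<close>).  Together they give the binomial
  theorem: \<open>\<alpha>\<^sup>-\<^sup>1(1 - t\<^sub>1 - \<dots> - t\<^sub>n)\<close> is a normalised sum over characters
  \<open>\<nu>\<^sub>1, \<dots>, \<nu>\<^sub>n\<close> of \<open>(\<alpha>)\<^sub>\<nu> \<Prod>\<^sub>i \<nu>\<^sub>i(t\<^sub>i) / (\<epsilon>)\<^sub>\<nu>\<^sub>i\<^sup>\<circ>\<close>, where \<open>\<nu> = \<nu>\<^sub>1\<cdots>\<nu>\<^sub>n\<close> (\<open>binomial_theorem\<close>).

  For the first hypersurface the factor \<open>(1 - \<Sum>\<^sub>i \<lambda>\<^sub>i x\<^sub>i)\<^sup>a\<close> is expanded by the \<open>n\<close>-variable binomial theorem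
  and the sum over \<open>x\<close> becomes a product of \<open>n\<close> binary Jacobi sums, each of which depends on
  \<open>\<nu>\<^sub>i\<close> through a ratio of Pochhammer symbols (\<open>jacobi_two_shift\<close>).  For the second one, each factor
  \<open>(x\<^sub>i - \<lambda>\<^sub>i)\<close> to the power \<open>b\<^sub>i\<close> is expanded by the one-variable binomial theorem and the sum over
  \<open>x\<close> becomes a single Jacobi sum in \<open>n + 1\<close> characters (\<open>simplex_sum_shift\<close>).  The coprimality
  hypotheses make exactly those characters nontrivial for which the binomial theorem or the
  evaluation of Jacobi sums by Gauss sums fails for the trivial character.
\<close>

section \<open>Roots in algebraically closed fields and in finite fields\<close>

text \<open>The polynomial \<open>Y\<^sup>d - c\<close> splits and is separable, as its derivative vanishes only at \<open>0\<close>.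
  This serves both for the roots of unity in the field of values and for the fibres of
  \<open>y \<mapsto> y\<^sup>d\<close> over the closure of \<open>\<kappa>\<close>.\<close>

lemma card_nth_roots:
  fixes c :: "'a::alg_closed_field"
  assumes d: "of_nat d \<noteq> (0::'a)" and c: "c \<noteq> 0"
  shows "card {y. y ^ d = c} = d"
proof -
  from d have d0: "d > 0" by (cases d) auto
  define p where "p = monom (1::'a) d - [:c:]"
  have deg: "degree p = d"
    unfolding p_def using d0 by (subst diff_conv_add_uminus, subst degree_add_eq_left)
      (auto simp: degree_monom_eq)
  have p0: "p \<noteq> 0" using deg d0 by auto
  have lc: "lead_coeff p = 1" unfolding deg using d0 by (cases d) (auto simp: p_def)
  obtain A where A: "size A = d" "p = (\<Prod>x\<in>#A. [:-x, 1:])"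
    using alg_closed_imp_factorization[OF p0] lc deg by auto
  have root: "poly p x = 0 \<longleftrightarrow> x \<in># A" for x
    unfolding A by (auto simp: poly_prod_mset prod_mset_zero_iff)
  have pd: "pderiv p = monom (of_nat d) (d - 1)"
    by (simp add: p_def pderiv_diff pderiv_monom pderiv_pCons)
  have "count A x \<le> 1" for x
  proof (rule ccontr)
    assume "\<not> count A x \<le> 1"
    then have "x \<in># A" "x \<in># A - {#x#}" by (auto simp: in_diff_count count_greater_zero_iff[symmetric] simp del: count_greater_zero_iff)
    then obtain B where B: "A = add_mset x (add_mset x B)"
      by (metis insert_DiffM)
    \<comment> \<open>A double root is also a root of the derivative \<open>d y\<^sup>d\<^sup>-\<^sup>1\<close>, hence is \<open>0\<close>.\<close>
    have "poly (pderiv p) x = 0"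
      unfolding A B by (simp add: pderiv_mult del: mult_pCons_left)
    then have "x = 0" using d by (auto simp: pd poly_monom)
    moreover have "poly p x = 0" using \<open>x \<in># A\<close> root by simp
    ultimately show False using c d0 by (simp add: p_def poly_monom zero_power)
  qed
  then have "count A x = 1" if "x \<in># A" for x
    using that by (metis One_nat_def Suc_leI count_greater_zero_iff le_antisym)
  then have "card (set_mset A) = d" using A(1) by (simp add: size_multiset_overloaded_eq)
  moreover have "{y. y ^ d = c} = set_mset A"
    using root by (auto simp: p_def poly_monom)
  ultimately show ?thesis by simp
qed

lemma card_power_eq_le:
  fixes c :: "'a::idom"
  assumes "d > 0"
  shows "finite {y. y ^ d = c}" and "card {y. y ^ d = c} \<le> d"
proof -
  define p where "p = monom (1::'a) d - [:c:]"
  have deg: "degree p = d"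
    unfolding p_def using assms by (subst diff_conv_add_uminus, subst degree_add_eq_left)
      (auto simp: degree_monom_eq)
  then have p0: "p \<noteq> 0" using assms by auto
  have "{y. y ^ d = c} = {y. poly p y = 0}" by (auto simp: p_def poly_monom)
  then show "finite {y. y ^ d = c}" "card {y. y ^ d = c} \<le> d"
    using poly_roots_finite[OF p0] card_poly_roots_bound[OF p0] deg by auto
qed

text \<open>Translation by \<open>1\<close> permutes the field, so the sum of all elements equals itself plus \<open>q\<close>.\<close>

lemma of_nat_card_eq_0: "of_nat CARD('k) = (0::'k::{field,finite})"
proof -
  have "(\<Sum>x\<in>(UNIV::'k set). x) = (\<Sum>x\<in>(UNIV::'k set). x + 1)"
    by (rule sum.reindex_bij_witness[of _ "\<lambda>x. x + 1" "\<lambda>x. x - 1"]) auto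
  then show ?thesis by (simp add: sum.distrib)
qed

lemma card_field_ge_2: "CARD('k::{field,finite}) \<ge> 2"
  using card_mono[of UNIV "{0,1::'k}"] by simp

lemma card_field_neq_1 [simp]: "CARD('k::{field,finite}) \<noteq> Suc 0"
  using card_field_ge_2[where 'k='k] by simp

lemma finite_field_cyclic:
  obtains g :: "'k::{field,finite}" where "g \<noteq> 0"
    and "bij_betw (\<lambda>i. g ^ i) {..<CARD('k) - 1} {x. x \<noteq> 0}" and "g ^ (CARD('k) - 1) = 1"
proof -
  let ?R = "ring_of_type_algebra :: 'k ring"
  interpret F: field ?R by (rule field_from_type_algebra)
  interpret G: group "Multiplicative_Group.mult_of ?R" by (rule F.field_mult_group)
  have carr: "carrier (Multiplicative_Group.mult_of ?R) = {x. x \<noteq> 0}" "\<one>\<^bsub>Multiplicative_Group.mult_of ?R\<^esub> = 1"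
    and mult: "x \<otimes>\<^bsub>Multiplicative_Group.mult_of ?R\<^esub> y = x * y" for x y
    by (auto simp: ring_of_type_algebra_def)
  have pow: "x [^]\<^bsub>Multiplicative_Group.mult_of ?R\<^esub> i = x ^ i" for x :: 'k and i :: nat
    by (induction i) (auto simp: carr(2) mult mult.commute simp del: Multiplicative_Group.mult_mult_of Multiplicative_Group.one_mult_of)
  have cardC: "card {x::'k. x \<noteq> 0} = CARD('k) - 1"
  proof -
    have "{x::'k. x \<noteq> 0} = UNIV - {0}" by auto
    then show ?thesis by (simp only: card_Diff_singleton[OF UNIV_I])
  qed
  obtain g where g: "g \<noteq> 0" "{x::'k. x \<noteq> 0} = {g ^ i |i. i \<in> UNIV}"
  proof -
    have "\<exists>g\<in>{x::'k. x \<noteq> 0}. {x::'k. x \<noteq> 0} = {g ^ i |i. i \<in> UNIV}"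
      using F.finite_field_mult_group_has_gen
      unfolding carr Multiplicative_Group.nat_pow_mult_of[symmetric] pow
      by (auto simp: ring_of_type_algebra_def)
    then show ?thesis using that by blast
  qed
  have g1: "g ^ (CARD('k) - 1) = 1"
    using G.pow_order_eq_1[of g] g(1) unfolding pow carr Coset.order_def cardC by blast
  let ?N = "CARD('k) - 1"
  have N: "?N > 0" using card_field_ge_2[where 'k='k] by simp
  have "g ^ i \<in> (\<lambda>i. g ^ i) ` {..<?N}" for i
  proof -
    have "g ^ i = g ^ (?N * (i div ?N) + i mod ?N)" by simp
    also have "\<dots> = g ^ (i mod ?N)" unfolding power_add power_mult g1 by simp
    finally show ?thesis using N by auto
  qed
  then have "{x. x \<noteq> 0} \<subseteq> (\<lambda>i. g ^ i) ` {..<?N}" unfolding g(2) by blast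
  moreover have "(\<lambda>i. g ^ i) ` {..<?N} \<subseteq> {x. x \<noteq> 0}" using g(1) by auto
  ultimately have im: "(\<lambda>i. g ^ i) ` {..<?N} = {x. x \<noteq> 0}" by (rule equalityI[rotated])
  have "inj_on (\<lambda>i. g ^ i) {..<?N}"
    by (rule eq_card_imp_inj_on) (simp_all only: im cardC card_lessThan finite_lessThan)
  with im show ?thesis by (intro that[OF g(1) _ g1]) (simp only: bij_betw_def)
qed

lemma finite_field_power_eq_1:
  fixes x :: "'k::{field,finite}"
  assumes "x \<noteq> 0"
  shows "x ^ (CARD('k) - 1) = 1"
proof -
  obtain g :: 'k where g: "bij_betw (\<lambda>i. g ^ i) {..<CARD('k) - 1} {x. x \<noteq> 0}" "g ^ (CARD('k) - 1) = 1"
    by (rule finite_field_cyclic)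
  then obtain i where "x = g ^ i" using assms by (auto simp: bij_betw_def)
  then show ?thesis using g(2) by (metis mult.commute power_mult power_one)
qed

text \<open>The equation \<open>x\<^sup>q = x\<close> has at most \<open>q\<close> solutions, and the \<open>q\<close> rational points are among them.\<close>

lemma frobenius_fixed_iff:
  fixes x :: "'k::{field,finite} alg_closure"
  shows "x ^ CARD('k) = x \<longleftrightarrow> x \<in> range to_ac"
proof -
  let ?q = "CARD('k)"
  have q: "?q = Suc (?q - 1)" using card_field_ge_2[where 'k='k] by simp
  have *: "{x::'k alg_closure. x ^ ?q = x} = insert 0 {x. x ^ (?q - 1) = 1}"
  proof -
    have "x ^ ?q = x * x ^ (?q - 1)" for x :: "'k alg_closure" by (metis q power_Suc)
    then show ?thesis by auto
  qed
  have sub: "range to_ac \<subseteq> {x::'k alg_closure. x ^ ?q = x}"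
    unfolding * by (auto simp: to_ac_power[symmetric] finite_field_power_eq_1 simp del: to_ac_power One_nat_def)
  have q1: "?q - 1 > 0" using card_field_ge_2[where 'k='k] by simp
  note cl = card_power_eq_le[OF q1, of "1::'k alg_closure"]
  have "card {x::'k alg_closure. x ^ ?q = x} \<le> ?q"
    unfolding * by (rule card_insert_le_m1) (use cl card_field_ge_2[where 'k='k] in auto)
  moreover have "card (range (to_ac :: 'k \<Rightarrow> _)) = ?q" by (rule card_image) (rule inj_to_ac)
  moreover have "finite {x::'k alg_closure. x ^ ?q = x}" unfolding * using cl by simp
  ultimately have "range to_ac = {x::'k alg_closure. x ^ ?q = x}"
    by (intro card_seteq sub) auto
  then show ?thesis by auto
qed

section \<open>Multiplicative characters\<close>

lemma carrier_char_group [simp]: "carrier char_group = mult_chars"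
  by (simp add: char_group_def)

lemma char_mult_apply [simp]: "(\<alpha> \<otimes>\<^bsub>char_group\<^esub> \<beta>) x = \<alpha> x * \<beta> x"
  by (simp add: char_group_def)

lemma char_one_apply [simp]: "\<one>\<^bsub>char_group\<^esub> x = (if x = 0 then 0 else 1)"
  by (simp add: char_group_def)

interpretation chars: comm_group "char_group :: ('k::{field,finite} \<Rightarrow> qbar) monoid"
  by (rule comm_group_char_group)

lemmas char_closed [simp] =
  chars.m_closed[unfolded carrier_char_group] chars.one_closed[unfolded carrier_char_group]
  chars.inv_closed[unfolded carrier_char_group] chars.int_pow_closed[unfolded carrier_char_group]
  chars.nat_pow_closed[unfolded carrier_char_group]

lemma char_0 [simp]: "\<eta> \<in> mult_chars \<Longrightarrow> \<eta> 0 = 0"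
  and char_mult: "\<eta> \<in> mult_chars \<Longrightarrow> \<eta> (x * y) = \<eta> x * \<eta> y"
  and char_eq_0_iff: "\<eta> \<in> mult_chars \<Longrightarrow> \<eta> x = 0 \<longleftrightarrow> x = 0"
  by (cases "x = 0"; cases "y = 0"; auto simp: mult_chars_iff)+

lemma char_1 [simp]: "\<eta> \<in> mult_chars \<Longrightarrow> \<eta> 1 = 1"
  using char_mult[of \<eta> 1 1] char_eq_0_iff[of \<eta> 1] by simp

lemma char_inverse: "\<eta> \<in> mult_chars \<Longrightarrow> \<eta> (inverse x) = inverse (\<eta> x)"
  using char_mult[of \<eta> x "inverse x"]
  by (cases "x = 0") (auto simp: char_eq_0_iff inverse_unique)

lemma char_divide: "\<eta> \<in> mult_chars \<Longrightarrow> \<eta> (x / y) = \<eta> x / \<eta> y"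
  by (simp add: divide_inverse char_mult char_inverse)

lemma char_power: "\<eta> \<in> mult_chars \<Longrightarrow> \<eta> (x ^ n) = \<eta> x ^ n"
  by (induction n) (auto simp: char_mult)

lemma char_prod: "\<eta> \<in> mult_chars \<Longrightarrow> \<eta> (\<Prod>i\<in>I. f i) = (\<Prod>i\<in>I. \<eta> (f i))"
  by (induction I rule: infinite_finite_induct) (auto simp: char_mult)

lemma char_minus_one_sq: "\<eta> \<in> mult_chars \<Longrightarrow> \<eta> (-1) * \<eta> (-1) = 1"
  by (simp flip: char_mult)

lemma char_minus_one_neq_0: "\<eta> \<in> mult_chars \<Longrightarrow> \<eta> (-1) \<noteq> 0"
  by (simp add: char_eq_0_iff)

lemma char_inv_apply [simp]:
  assumes "\<eta> \<in> mult_chars"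
  shows "(inv\<^bsub>char_group\<^esub> \<eta>) x = inverse (\<eta> x)"
proof -
  have "(\<eta> \<otimes>\<^bsub>char_group\<^esub> inv\<^bsub>char_group\<^esub> \<eta>) x = \<one>\<^bsub>char_group\<^esub> x"
    using assms by (simp only: chars.r_inv carrier_char_group)
  then have "x \<noteq> 0 \<Longrightarrow> \<eta> x * (inv\<^bsub>char_group\<^esub> \<eta>) x = 1" by simp
  then show ?thesis using assms inverse_unique[of "\<eta> x"] by (cases "x = 0") auto
qed

lemma char_nat_pow_apply:
  "\<eta> \<in> mult_chars \<Longrightarrow> (\<eta> [^]\<^bsub>char_group\<^esub> (n::nat)) x = (if x = 0 then 0 else \<eta> x ^ n)"
  by (induction n) auto

lemma char_int_pow_apply:
  assumes "\<eta> \<in> mult_chars"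
  shows "(\<eta> [^]\<^bsub>char_group\<^esub> (n::int)) x = (if x = 0 then 0 else \<eta> x powi n)"
proof (cases n rule: int_cases2)
  case (nonneg k)
  then show ?thesis
    by (simp only: int_pow_int char_nat_pow_apply[OF assms] power_int_of_nat)
next
  case (nonpos k)
  then have "\<eta> [^]\<^bsub>char_group\<^esub> n = inv\<^bsub>char_group\<^esub> (\<eta> [^]\<^bsub>char_group\<^esub> k)"
    using chars.int_pow_neg_int[of \<eta> k] assms by (simp only: carrier_char_group)
  then show ?thesis
    using nonpos assms by (simp add: char_nat_pow_apply power_int_minus)
qed

lemma char_finprod_apply:
  "\<nu> \<in> I \<rightarrow> mult_chars \<Longrightarrow> finite I \<Longrightarrow> x \<noteq> 0 \<Longrightarrow>
     (\<Otimes>\<^bsub>char_group\<^esub>i\<in>I. \<nu> i) x = (\<Prod>i\<in>I. \<nu> i x)"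
  by (induction I rule: infinite_finite_induct) (auto simp: Pi_iff)

lemma char_eqI: "\<alpha> \<in> mult_chars \<Longrightarrow> \<beta> \<in> mult_chars \<Longrightarrow> (\<And>x. x \<noteq> 0 \<Longrightarrow> \<alpha> x = \<beta> x) \<Longrightarrow> \<alpha> = \<beta>"
  by (rule ext) (metis char_0)

lemma sum_nontrivial_char:
  assumes \<eta>: "\<eta> \<in> mult_chars" "\<eta> \<noteq> \<one>\<^bsub>char_group\<^esub>"
  shows "(\<Sum>x\<in>UNIV. \<eta> x) = 0"
proof -
  obtain y where y: "y \<noteq> 0" "\<eta> y \<noteq> 1" using \<eta> char_eqI[of \<eta> "\<one>\<^bsub>char_group\<^esub>"] by auto
  have "(\<Sum>x\<in>UNIV. \<eta> x) = (\<Sum>x\<in>UNIV. \<eta> (y * x))"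
    by (rule sum.reindex_bij_witness[of _ "\<lambda>x. y * x" "\<lambda>x. x / y"]) (use y in auto)
  also have "\<dots> = \<eta> y * (\<Sum>x\<in>UNIV. \<eta> x)" using \<eta> by (simp add: char_mult sum_distrib_left)
  finally show ?thesis using y by simp
qed

text \<open>A character of a cyclic group is determined by its value at a generator \<open>g\<close>, and this
  value can be any \<open>(q-1)\<close>-th root of unity.  Hence there are as many characters as there are roots
  of unity in the field of values.\<close>

lemma mult_chars_roots_of_unity:
  obtains g :: "'k::{field,finite}" where "g \<noteq> 0"
    and "bij_betw (\<lambda>i. g ^ i) {..<CARD('k) - 1} {x. x \<noteq> 0}"
    and "bij_betw (\<lambda>\<nu>. \<nu> g) mult_chars {z::qbar. z ^ (CARD('k) - 1) = 1}"
proof -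
  let ?N = "CARD('k) - 1"
  obtain g :: 'k where g: "g \<noteq> 0" "bij_betw (\<lambda>i. g ^ i) {..<?N} {x. x \<noteq> 0}" "g ^ ?N = 1"
    by (rule finite_field_cyclic)
  have N: "?N > 0" using card_field_ge_2[where 'k='k] by simp
  have ex: "\<exists>i<?N. x = g ^ i" if "x \<noteq> 0" for x
    using g(2) that by (auto simp: bij_betw_def set_eq_iff image_iff)
  have inj: "i = j" if "g ^ i = g ^ j" "i < ?N" "j < ?N" for i j
    using g(2) that by (auto simp: bij_betw_def inj_on_def)
  have mod: "g ^ i = g ^ (i mod ?N)" for i
  proof -
    have "g ^ i = g ^ (?N * (i div ?N) + i mod ?N)" by simp
    also have "\<dots> = g ^ (i mod ?N)" unfolding power_add power_mult g by simp
    finally show ?thesis .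
  qed
  have "bij_betw (\<lambda>\<nu>. \<nu> g) mult_chars {z::qbar. z ^ ?N = 1}"
  proof (rule bij_betw_imageI)
    show "inj_on (\<lambda>\<nu>::'k \<Rightarrow> qbar. \<nu> g) mult_chars"
    proof (rule inj_onI)
      fix \<mu> \<nu> :: "'k \<Rightarrow> qbar" assume *: "\<mu> \<in> mult_chars" "\<nu> \<in> mult_chars" "\<mu> g = \<nu> g"
      show "\<mu> = \<nu>" using * ex by (intro char_eqI) (auto simp: char_power dest!: ex)
    qed
    show "(\<lambda>\<nu>. \<nu> g) ` mult_chars = {z::qbar. z ^ ?N = 1}"
    proof (intro equalityI subsetI)
      fix z :: qbar assume "z \<in> {z::qbar. z ^ ?N = 1}"
      then have z: "z ^ ?N = 1" by simp
      then have z0: "z \<noteq> 0" using N by (auto simp: zero_power)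
      \<comment> \<open>The discrete logarithm to the base \<open>g\<close>.\<close>
      define lg where "lg x = (THE i. i < ?N \<and> x = g ^ i)" for x
      have lg: "lg x < ?N" "x = g ^ lg x" if "x \<noteq> 0" for x
        using theI'[of "\<lambda>i. i < ?N \<and> x = g ^ i"] ex[OF that] inj unfolding lg_def by auto
      have lgI: "lg (g ^ i) = i mod ?N" for i
        using lg[of "g ^ i"] mod[of i] inj[of "lg (g ^ i)" "i mod ?N"] N g(1) by auto
      have zmod: "z ^ (i mod ?N) = z ^ i" for i
      proof -
        have "z ^ i = z ^ (?N * (i div ?N) + i mod ?N)" by simp
        also have "\<dots> = z ^ (i mod ?N)" unfolding power_add power_mult z by simp
        finally show ?thesis by simp
      qed
      define \<nu> where "\<nu> x = (if x = 0 then 0 else z ^ lg x)" for x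
      have "\<nu> \<in> mult_chars"
        unfolding mult_chars_iff
      proof (intro conjI allI impI)
        fix x y :: 'k assume xy: "x \<noteq> 0" "y \<noteq> 0"
        have "x * y = g ^ (lg x + lg y)" using lg(2)[OF xy(1)] lg(2)[OF xy(2)] by (metis power_add)
        then have "lg (x * y) = (lg x + lg y) mod ?N" using lgI by metis
        then have "z ^ lg (x * y) = z ^ (lg x + lg y)" by (simp only: zmod)
        then show "\<nu> (x * y) = \<nu> x * \<nu> y" using xy by (simp add: \<nu>_def power_add)
      qed (auto simp: \<nu>_def z0)
      moreover have "\<nu> g = z"
        using g(1) lgI[of 1] zmod[of 1] by (simp add: \<nu>_def)
      ultimately show "z \<in> (\<lambda>\<nu>. \<nu> g) ` mult_chars" by auto
    next
      fix z :: qbar assume "z \<in> (\<lambda>\<nu>. \<nu> g) ` mult_chars"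
      then show "z \<in> {z. z ^ ?N = 1}" using g(3) by (auto simp flip: char_power simp del: One_nat_def)
    qed
  qed
  then show ?thesis using that g by blast
qed

lemma finite_mult_chars [simp]: "finite (mult_chars :: ('k::{field,finite} \<Rightarrow> qbar) set)"
proof -
  obtain g :: 'k where "bij_betw (\<lambda>\<nu>. \<nu> g) mult_chars {z::qbar. z ^ (CARD('k) - 1) = 1}"
    by (rule mult_chars_roots_of_unity)
  moreover have "finite {z::qbar. z ^ (CARD('k) - 1) = 1}"
    using card_field_ge_2[where 'k='k] by (intro card_power_eq_le) simp
  ultimately show ?thesis by (simp add: bij_betw_finite)
qed

lemma card_roots_of_unity_qbar:
  "CARD('k::{field,finite}) - 1 = card {z::qbar. z ^ (CARD('k) - 1) = 1}"
  using card_field_ge_2[where 'k='k] by (subst card_nth_roots) auto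

text \<open>For \<open>x = g\<^sup>i\<close> the sum runs over the \<open>i\<close>-th powers of the \<open>(q-1)\<close>-th roots of unity; it is invariant
  under multiplication by \<open>w\<^sup>i\<close> for each such root \<open>w\<close>.\<close>

lemma sum_mult_chars:
  fixes x :: "'k::{field,finite}"
  assumes "x \<noteq> 0"
  shows "(\<Sum>\<nu>\<in>mult_chars. \<nu> x) = (if x = 1 then of_nat CARD('k) - 1 else (0::qbar))"
proof -
  let ?N = "CARD('k) - 1" 
  let ?R = "{z::qbar. z ^ ?N = 1}"
  obtain g :: 'k where g: "g \<noteq> 0" "bij_betw (\<lambda>i. g ^ i) {..<?N} {x. x \<noteq> 0}"
    "bij_betw (\<lambda>\<nu>. \<nu> g) mult_chars ?R"
    by (rule mult_chars_roots_of_unity)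
  have N: "?N > 0" using card_field_ge_2[where 'k='k] by simp
  have finR: "finite ?R" using N by (rule card_power_eq_le)
  obtain i where i: "i < ?N" "x = g ^ i" using g(2) assms by (auto simp: bij_betw_def set_eq_iff image_iff)
  have "(\<Sum>\<nu>\<in>mult_chars. \<nu> x) = (\<Sum>\<nu>\<in>mult_chars. \<nu> g ^ i)"
    using i by (intro sum.cong) (auto simp: char_power)
  also have "\<dots> = (\<Sum>z\<in>?R. z ^ i)" using g(3) by (rule sum.reindex_bij_betw)
  finally have S: "(\<Sum>\<nu>\<in>mult_chars. \<nu> x) = (\<Sum>z\<in>?R. z ^ i)" .
  show ?thesis
  proof (cases "i = 0")
    case True
    then show ?thesis using S i N card_roots_of_unity_qbar[where 'k='k] by (simp add: of_nat_diff)
  next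
    case False
    \<comment> \<open>Not every \<open>z\<close> in \<open>?R\<close> satisfies \<open>z\<^sup>i = 1\<close>, as this equation has too few solutions.\<close>
    have "\<not> ?R \<subseteq> {z. z ^ i = 1}"
      using card_mono[OF card_power_eq_le(1), of i ?R 1] card_power_eq_le(2)[of i "1::qbar"]
        card_roots_of_unity_qbar[where 'k='k] False i(1) by linarith
    then obtain w :: qbar where w: "w ^ ?N = 1" "w ^ i \<noteq> 1" by auto
    then have w0: "w \<noteq> 0" using N by (auto simp: zero_power)
    have "(\<Sum>z\<in>?R. z ^ i) = (\<Sum>z\<in>?R. (w * z) ^ i)"
      by (rule sum.reindex_bij_witness[of _ "\<lambda>z. w * z" "\<lambda>z. z / w"])
        (use w w0 in \<open>auto simp: power_mult_distrib power_divide\<close>)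
    also have "\<dots> = w ^ i * (\<Sum>z\<in>?R. z ^ i)" by (simp add: power_mult_distrib sum_distrib_left)
    finally have "(\<Sum>z\<in>?R. z ^ i) = 0" using w by simp
    moreover have "x \<noteq> 1"
      using inj_onD[OF bij_betw_imp_inj_on[OF g(2)], of i 0] False i N by auto
    ultimately show ?thesis using S by simp
  qed
qed

section \<open>Gauss sums\<close>

lemma char_inv_eq_one_iff:
  "\<eta> \<in> mult_chars \<Longrightarrow> inv\<^bsub>char_group\<^esub> \<eta> = \<one>\<^bsub>char_group\<^esub> \<longleftrightarrow> \<eta> = \<one>\<^bsub>char_group\<^esub>"
  using chars.inv_eq_1_iff[of \<eta>] by simp

lemma char_inv_inv: "\<eta> \<in> mult_chars \<Longrightarrow> inv\<^bsub>char_group\<^esub> (inv\<^bsub>char_group\<^esub> \<eta>) = \<eta>"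
  using chars.inv_inv[of \<eta>] by simp

lemma card_neq_0_qbar [simp]: "(of_nat CARD('k::{field,finite}) :: qbar) \<noteq> 0"
  and one_minus_card_neq_0 [simp]: "1 - (of_nat CARD('k::{field,finite}) :: qbar) \<noteq> 0"
proof -
  show "(of_nat CARD('k) :: qbar) \<noteq> 0" using card_field_ge_2[where 'k='k] by simp
  have "(of_nat CARD('k) :: qbar) \<noteq> of_nat 1"
    unfolding of_nat_eq_iff using card_field_ge_2[where 'k='k] by simp
  then show "1 - (of_nat CARD('k) :: qbar) \<noteq> 0" by simp
qed

context
  fixes \<psi> :: "'k::{field,finite} \<Rightarrow> qbar"
  assumes \<psi>: "nontrivial_add_char \<psi>"
begin

lemma psi_neq_0: "\<psi> x \<noteq> 0" and psi_add: "\<psi> (x + y) = \<psi> x * \<psi> y"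
  using \<psi> by (auto simp: nontrivial_add_char_def add_chars_iff)

lemma psi_0: "\<psi> 0 = 1"
  using psi_add[of 0 0] psi_neq_0[of 0] by simp

lemma psi_sum: "\<psi> (\<Sum>i\<in>I. f i) = (\<Prod>i\<in>I. \<psi> (f i))"
  by (induction I rule: infinite_finite_induct) (auto simp: psi_add psi_0)

text \<open>A translation by some \<open>z\<close> with \<open>\<psi>(z) \<noteq> 1\<close> multiplies the sum by \<open>\<psi>(z)\<close>.\<close>

lemma sum_psi: "(\<Sum>x\<in>UNIV. \<psi> (x * y)) = (if y = 0 then of_nat CARD('k) else 0)"
proof (cases "y = 0")
  case False
  obtain z where z: "\<psi> z \<noteq> 1" using \<psi> by (auto simp: nontrivial_add_char_def)
  have "(\<Sum>x\<in>UNIV. \<psi> (x * y)) = (\<Sum>x\<in>UNIV. \<psi> x)"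
    by (rule sum.reindex_bij_witness[of _ "\<lambda>x. x / y" "\<lambda>x. x * y"]) (use False in auto)
  moreover have "(\<Sum>x\<in>UNIV. \<psi> x) = 0"
  proof -
    have "(\<Sum>x\<in>UNIV. \<psi> x) = (\<Sum>x\<in>UNIV. \<psi> (z + x))"
      by (rule sum.reindex_bij_witness[of _ "\<lambda>x. z + x" "\<lambda>x. x - z"]) auto
    also have "\<dots> = \<psi> z * (\<Sum>x\<in>UNIV. \<psi> x)" by (simp add: psi_add sum_distrib_left)
    finally show ?thesis using z by simp
  qed
  ultimately show ?thesis using False by simp
qed (simp add: psi_0)

lemma gauss_eq: 
  assumes "\<eta> \<in> mult_chars" shows "gauss \<psi> \<eta> = - (\<Sum>x\<in>UNIV. \<psi> x * \<eta> x)"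
  unfolding gauss_def by (subst sum.mono_neutral_left[of UNIV]) (use assms in auto)

text \<open>For \<open>y \<noteq> 0\<close> substitute \<open>x / y\<close> for \<open>x\<close>.  For \<open>y = 0\<close> the right-hand side is \<open>0\<close> because
  \<open>inverse 0 = 0\<close>, and the left-hand side vanishes for a nontrivial \<open>\<eta>\<close>.  Covering this case is what
  later lets the sums run over all of affine space, including the zeros of the integrand.\<close>

lemma gauss_twist:
  assumes \<eta>: "\<eta> \<in> mult_chars" and y: "y \<noteq> 0 \<or> \<eta> \<noteq> \<one>\<^bsub>char_group\<^esub>"
  shows "(\<Sum>x\<in>UNIV. \<eta> x * \<psi> (x * y)) = - inverse (\<eta> y) * gauss \<psi> \<eta>"
proof (cases "y = 0")
  case True
  then show ?thesis using y \<eta> sum_nontrivial_char[OF \<eta>] by (simp add: psi_0)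
next
  case False
  have "(\<Sum>x\<in>UNIV. \<eta> x * \<psi> (x * y)) = (\<Sum>x\<in>UNIV. \<eta> (x / y) * \<psi> x)"
    by (rule sum.reindex_bij_witness[of _ "\<lambda>x. x / y" "\<lambda>x. x * y"]) (use False in auto)
  also have "\<dots> = - inverse (\<eta> y) * gauss \<psi> \<eta>"
    using \<eta> by (simp add: gauss_eq char_divide sum_distrib_left sum_negf field_simps)
  finally show ?thesis .
qed

lemma gauss_one: "gauss \<psi> \<one>\<^bsub>char_group\<^esub> = 1"
proof -
  have "gauss \<psi> \<one>\<^bsub>char_group\<^esub> = - (\<Sum>x | x \<noteq> 0. \<psi> x)"
    by (simp add: gauss_def)
  also have "{x::'k. x \<noteq> 0} = UNIV - {0}" by auto
  also have "(\<Sum>x\<in>UNIV - {0}. \<psi> x) = (\<Sum>x\<in>UNIV. \<psi> x) - \<psi> 0"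
    by (simp add: sum_diff1)
  also have "\<dots> = -1" using sum_psi[of 1] by (simp add: psi_0)
  finally show ?thesis by (simp only: minus_minus)
qed

text \<open>The factor \<open>q\<close> in \<open>g\<^sup>\<circ>(\<epsilon>)\<close> is chosen such that the reflection formula holds for the
  trivial character as well.\<close>

lemma gauss_circ_reflection:
  assumes \<nu>: "\<nu> \<in> mult_chars"
  shows "gauss_circ \<psi> \<nu> * gauss \<psi> (inv\<^bsub>char_group\<^esub> \<nu>) = \<nu> (-1) * of_nat CARD('k)"
proof (cases "\<nu> = \<one>\<^bsub>char_group\<^esub>")
  case True
  then show ?thesis by (simp add: gauss_circ_def char_delta_def gauss_one)
next
  case False
  have "gauss \<psi> \<nu> * gauss \<psi> (inv\<^bsub>char_group\<^esub> \<nu>) =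
      (\<Sum>y\<in>UNIV. \<psi> y * (- inverse (\<nu> y) * gauss \<psi> \<nu>))"
    using \<nu> by (simp add: gauss_eq[of "inv\<^bsub>char_group\<^esub> \<nu>"] sum_distrib_left sum_negf mult_ac)
  also have "\<dots> = (\<Sum>y\<in>UNIV. \<psi> y * (\<Sum>x\<in>UNIV. \<nu> x * \<psi> (x * y)))"
    using False by (simp only: gauss_twist[OF \<nu> disjI2] not_False_eq_True)
  also have "\<dots> = (\<Sum>y\<in>UNIV. \<Sum>x\<in>UNIV. \<nu> x * \<psi> (y * (x + 1)))"
    by (simp add: sum_distrib_left algebra_simps psi_add)
  also have "\<dots> = (\<Sum>x\<in>UNIV. \<nu> x * (\<Sum>y\<in>UNIV. \<psi> (y * (x + 1))))"
    by (subst sum.swap) (simp add: sum_distrib_left)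
  also have "\<dots> = (\<Sum>x\<in>UNIV. if x = -1 then \<nu> x * of_nat CARD('k) else 0)"
    by (intro sum.cong) (auto simp: sum_psi eq_neg_iff_add_eq_0)
  also have "\<dots> = \<nu> (-1) * of_nat CARD('k)" by simp
  finally show ?thesis using False by (simp add: gauss_circ_def char_delta_def)
qed

lemma gauss_neq_0: "\<nu> \<in> mult_chars \<Longrightarrow> gauss \<psi> \<nu> \<noteq> 0"
  using gauss_circ_reflection[of "inv\<^bsub>char_group\<^esub> \<nu>"] by (auto simp: char_inv_inv char_eq_0_iff)

text \<open>The reflection formula moves the Gauss sums in the denominators of the Lauricella
  function into numerators, where they can be expanded and summed.\<close>

lemma inverse_poch_circ:
  assumes \<gamma>: "\<gamma> \<in> mult_chars" and \<nu>: "\<nu> \<in> mult_chars"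
  shows "inverse (poch_circ \<psi> \<gamma> \<nu>) =
     \<nu> (-1) * gauss \<psi> (inv\<^bsub>char_group\<^esub> (\<gamma> \<otimes>\<^bsub>char_group\<^esub> \<nu>)) / gauss \<psi> (inv\<^bsub>char_group\<^esub> \<gamma>)"
proof -
  have *: "gauss_circ \<psi> \<alpha> = \<alpha> (-1) * of_nat CARD('k) / gauss \<psi> (inv\<^bsub>char_group\<^esub> \<alpha>)"
    if "\<alpha> \<in> mult_chars" for \<alpha>
    using gauss_circ_reflection[OF that] that by (simp add: gauss_neq_0 field_simps)
  have "poch_circ \<psi> \<gamma> \<nu> = \<nu> (-1) * gauss \<psi> (inv\<^bsub>char_group\<^esub> \<gamma>) /
      gauss \<psi> (inv\<^bsub>char_group\<^esub> (\<gamma> \<otimes>\<^bsub>char_group\<^esub> \<nu>))"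
    unfolding poch_circ_def *[OF \<gamma>] *[OF char_closed(1)[OF \<gamma> \<nu>]]
    using \<gamma> \<nu> char_minus_one_neq_0[OF \<gamma>] by (simp add: gauss_neq_0)
  then show ?thesis
    using inverse_unique[OF char_minus_one_sq[OF \<nu>]] by (simp add: divide_inverse mult_ac)
qed

lemma inverse_poch_circ_one:
  "\<nu> \<in> mult_chars \<Longrightarrow>
     inverse (poch_circ \<psi> \<one>\<^bsub>char_group\<^esub> \<nu>) = \<nu> (-1) * gauss \<psi> (inv\<^bsub>char_group\<^esub> \<nu>)"
  by (simp add: inverse_poch_circ gauss_one)

text \<open>Expand the Gauss sum and interchange: orthogonality of characters leaves only \<open>x = t\<close>.\<close>

lemma psi_mellin:
  assumes "t \<noteq> 0"
  shows "(\<Sum>\<nu>\<in>mult_chars. gauss \<psi> (inv\<^bsub>char_group\<^esub> \<nu>) * \<nu> t) = (1 - of_nat CARD('k)) * \<psi> t"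
proof -
  have "(\<Sum>\<nu>\<in>mult_chars. gauss \<psi> (inv\<^bsub>char_group\<^esub> \<nu>) * \<nu> t) =
      (\<Sum>\<nu>\<in>mult_chars. \<Sum>x | x \<noteq> 0. - \<psi> x * \<nu> (t / x))"
    by (intro sum.cong)
      (auto simp: gauss_def sum_distrib_left sum_distrib_right sum_negf char_divide field_simps)
  also have "\<dots> = (\<Sum>x | x \<noteq> 0. - \<psi> x * (\<Sum>\<nu>\<in>mult_chars. \<nu> (t / x)))"
    by (subst sum.swap) (simp add: sum_distrib_left sum_negf)
  also have "\<dots> = (\<Sum>x | x \<noteq> 0. if x = t then - \<psi> x * (of_nat CARD('k) - 1) else 0)"
    using assms by (intro sum.cong) (auto simp: sum_mult_chars)
  also have "\<dots> = (1 - of_nat CARD('k)) * \<psi> t" using assms by (simp add: algebra_simps)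
  finally show ?thesis .
qed

lemma psi_mellin_poch_circ:
  assumes "t \<noteq> 0"
  shows "(\<Sum>\<nu>\<in>mult_chars. \<nu> t / poch_circ \<psi> \<one>\<^bsub>char_group\<^esub> \<nu>) = (1 - of_nat CARD('k)) * \<psi> (- t)"
proof -
  have "\<nu> t / poch_circ \<psi> \<one>\<^bsub>char_group\<^esub> \<nu> = gauss \<psi> (inv\<^bsub>char_group\<^esub> \<nu>) * \<nu> (- t)"
    if "\<nu> \<in> mult_chars" for \<nu>
    using that char_mult[OF that, of "-1" t] by (simp add: divide_inverse inverse_poch_circ_one)
  then show ?thesis using psi_mellin[of "- t"] assms by simp
qed

section \<open>The binomial theorem over a finite field\<close>

text \<open>After multiplication by \<open>g(\<alpha>)\<close>, the numerator \<open>g(\<alpha>\<nu>\<^sub>1\<cdots>\<nu>\<^sub>n)\<close> is expanded as a sum over \<open>u\<close>.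
  The sum over the characters then factors into \<open>n\<close> copies of the Fourier expansion of \<open>\<psi>(-t\<^sub>i u)\<close>,
  and what is left over is the twisted Gauss sum of \<open>\<alpha>\<close> at \<open>1 - \<Sum>\<^sub>i t\<^sub>i\<close>.\<close>

lemma binomial_theorem:
  assumes I: "finite I" and \<alpha>: "\<alpha> \<in> mult_chars" "\<alpha> \<noteq> \<one>\<^bsub>char_group\<^esub>" and t: "\<And>i. i \<in> I \<Longrightarrow> t i \<noteq> 0"
  shows "(\<Sum>\<nu>\<in>I \<rightarrow>\<^sub>E mult_chars. poch \<psi> \<alpha> (\<Otimes>\<^bsub>char_group\<^esub>i\<in>I. \<nu> i) *
            (\<Prod>i\<in>I. \<nu> i (t i) / poch_circ \<psi> \<one>\<^bsub>char_group\<^esub> (\<nu> i))) =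
         (1 - of_nat CARD('k)) ^ card I * inverse (\<alpha> (1 - (\<Sum>i\<in>I. t i)))" (is "?L = ?R")
proof -
  let ?c = "\<lambda>\<nu> t. \<nu> t / poch_circ \<psi> \<one>\<^bsub>char_group\<^esub> \<nu>"
  have *: "gauss \<psi> (\<alpha> \<otimes>\<^bsub>char_group\<^esub> (\<Otimes>\<^bsub>char_group\<^esub>i\<in>I. \<nu> i)) * (\<Prod>i\<in>I. ?c (\<nu> i) (t i))
      = (\<Sum>u | u \<noteq> 0. - (\<psi> u * \<alpha> u) * (\<Prod>i\<in>I. ?c (\<nu> i) (t i * u)))"
    if \<nu>: "\<nu> \<in> I \<rightarrow>\<^sub>E mult_chars" for \<nu>
  proof -
    have "(\<Prod>i\<in>I. \<nu> i u) * (\<Prod>i\<in>I. ?c (\<nu> i) (t i)) = (\<Prod>i\<in>I. ?c (\<nu> i) (t i * u))" for u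
      unfolding prod.distrib[symmetric] using \<nu> by (intro prod.cong) (auto simp: char_mult Pi_iff PiE_iff)
    moreover have "(\<Otimes>\<^bsub>char_group\<^esub>i\<in>I. \<nu> i) u = (\<Prod>i\<in>I. \<nu> i u)" if "u \<noteq> 0" for u
      using that \<nu> I by (intro char_finprod_apply) auto
    ultimately show ?thesis
      by (simp add: gauss_def sum_distrib_right sum_negf mult.assoc)
  qed
  have "gauss \<psi> \<alpha> * ?L = (\<Sum>\<nu>\<in>I \<rightarrow>\<^sub>E mult_chars. \<Sum>u | u \<noteq> 0.
      - (\<psi> u * \<alpha> u) * (\<Prod>i\<in>I. ?c (\<nu> i) (t i * u)))"
    unfolding sum_distrib_left using \<alpha> gauss_neq_0[OF \<alpha>(1)]
    by (intro sum.cong refl, subst *[symmetric]) (simp_all add: poch_def)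
  also have "\<dots> = (\<Sum>u | u \<noteq> 0. - (\<psi> u * \<alpha> u) *
      (\<Sum>\<nu>\<in>I \<rightarrow>\<^sub>E mult_chars. \<Prod>i\<in>I. ?c (\<nu> i) (t i * u)))"
    by (subst sum.swap) (simp add: sum_distrib_left)
  also have "\<dots> = (\<Sum>u | u \<noteq> 0. - (\<psi> u * \<alpha> u) * (\<Prod>i\<in>I. \<Sum>\<nu>\<in>mult_chars. ?c \<nu> (t i * u)))"
    by (subst prod_sum_PiE[OF I]) simp_all
  also have "\<dots> = (\<Sum>u | u \<noteq> 0. - (\<psi> u * \<alpha> u) *
      (\<Prod>i\<in>I. (1 - of_nat CARD('k)) * \<psi> (- (t i * u))))"
    using t by (intro sum.cong prod.cong arg_cong2[where f = "(*)"] refl psi_mellin_poch_circ) auto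
  also have "\<dots> = (\<Sum>u | u \<noteq> 0. - ((1 - of_nat CARD('k)) ^ card I) * (\<alpha> u * \<psi> (u * (1 - (\<Sum>i\<in>I. t i)))))"
  proof (intro sum.cong refl)
    fix u
    have "\<psi> u * (\<Prod>i\<in>I. \<psi> (- (t i * u))) = \<psi> (u * (1 - (\<Sum>i\<in>I. t i)))"
      by (simp add: psi_sum[symmetric] psi_add[symmetric] sum_negf sum_distrib_left algebra_simps)
    then show "- (\<psi> u * \<alpha> u) * (\<Prod>i\<in>I. (1 - of_nat CARD('k)) * \<psi> (- (t i * u))) =
      - ((1 - of_nat CARD('k)) ^ card I) * (\<alpha> u * \<psi> (u * (1 - (\<Sum>i\<in>I. t i))))"
      by (simp add: prod.distrib flip: mult.assoc)
  qed
  also have "\<dots> = - ((1 - of_nat CARD('k)) ^ card I) *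
       (\<Sum>u\<in>UNIV. \<alpha> u * \<psi> (u * (1 - (\<Sum>i\<in>I. t i))))"
    unfolding sum_distrib_left by (rule sum.mono_neutral_left) (use \<alpha> in auto)
  also have "\<dots> = gauss \<psi> \<alpha> * ?R"
    using \<alpha> by (simp add: gauss_twist)
  finally show ?thesis using gauss_neq_0[OF \<alpha>(1)] by simp
qed

lemma sum_PiE_singleton: "(\<Sum>f\<in>{i} \<rightarrow>\<^sub>E S. h (f i)) = (\<Sum>x\<in>S. h x)"
  by (rule sum.reindex_bij_witness[of _ "\<lambda>x. \<lambda>j\<in>{i}. x" "\<lambda>f. f i"])
    (auto simp: PiE_iff fun_eq_iff extensional_def)

lemma binomial_theorem_one:
  assumes \<beta>: "\<beta> \<in> mult_chars" "\<beta> \<noteq> \<one>\<^bsub>char_group\<^esub>" and t: "t \<noteq> 0"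
  shows "(\<Sum>\<nu>\<in>mult_chars. poch \<psi> (inv\<^bsub>char_group\<^esub> \<beta>) \<nu> * (\<nu> t / poch_circ \<psi> \<one>\<^bsub>char_group\<^esub> \<nu>)) =
    (1 - of_nat CARD('k)) * \<beta> (1 - t)"
proof -
  have "(\<Sum>\<nu>\<in>{0::nat} \<rightarrow>\<^sub>E mult_chars. poch \<psi> (inv\<^bsub>char_group\<^esub> \<beta>) (\<Otimes>\<^bsub>char_group\<^esub>i\<in>{0}. \<nu> i) *
            (\<Prod>i\<in>{0}. \<nu> i t / poch_circ \<psi> \<one>\<^bsub>char_group\<^esub> (\<nu> i))) =
        (\<Sum>\<nu>\<in>{0::nat} \<rightarrow>\<^sub>E mult_chars. poch \<psi> (inv\<^bsub>char_group\<^esub> \<beta>) (\<nu> 0) *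
            (\<nu> 0 t / poch_circ \<psi> \<one>\<^bsub>char_group\<^esub> (\<nu> 0)))"
    by (intro sum.cong refl) (auto simp: PiE_iff)
  then show ?thesis
    using binomial_theorem[of "{0::nat}" "inv\<^bsub>char_group\<^esub> \<beta>" "\<lambda>_. t"] \<beta> t
      sum_PiE_singleton[of "\<lambda>\<nu>. poch \<psi> (inv\<^bsub>char_group\<^esub> \<beta>) \<nu> *
        (\<nu> t / poch_circ \<psi> \<one>\<^bsub>char_group\<^esub> \<nu>)" "0::nat" mult_chars]
    by (simp add: char_inv_eq_one_iff)
qed

section \<open>Jacobi sums\<close>

text \<open>The Jacobi sum in affine coordinates: the summand \<open>\<alpha>(1 - \<Sum>\<^sub>i x\<^sub>i)\<close> is written as an additive
  Fourier transform, upon which the sum over \<open>x\<close> separates into twisted Gauss sums of the \<open>\<theta>\<^sub>i\<close>.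
  With \<open>g(\<alpha>\<^sup>-\<^sup>1)\<close> on the left, the formula is the same whether or not the product of all the
  characters is trivial.\<close>

lemma simplex_sum_gauss:
  assumes I: "finite I" and \<alpha>: "\<alpha> \<in> mult_chars" "\<alpha> \<noteq> \<one>\<^bsub>char_group\<^esub>" and \<theta>: "\<And>i. i \<in> I \<Longrightarrow> \<theta> i \<in> mult_chars"
  shows "gauss \<psi> (inv\<^bsub>char_group\<^esub> \<alpha>) *
      (\<Sum>x\<in>I \<rightarrow>\<^sub>E UNIV. \<alpha> (1 - (\<Sum>i\<in>I. x i)) * (\<Prod>i\<in>I. \<theta> i (x i))) =
    (\<Prod>i\<in>I. - \<theta> i (-1) * gauss \<psi> (\<theta> i)) *
      gauss \<psi> (inv\<^bsub>char_group\<^esub> (\<alpha> \<otimes>\<^bsub>char_group\<^esub> (\<Otimes>\<^bsub>char_group\<^esub>i\<in>I. \<theta> i)))"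
proof -
  let ?\<alpha>' = "inv\<^bsub>char_group\<^esub> \<alpha>"
  have \<alpha>': "?\<alpha>' \<in> mult_chars" "?\<alpha>' \<noteq> \<one>\<^bsub>char_group\<^esub>" using \<alpha> by (auto simp: char_inv_eq_one_iff)
  have \<alpha>y: "gauss \<psi> ?\<alpha>' * \<alpha> y = - (\<Sum>u\<in>UNIV. ?\<alpha>' u * \<psi> (u * y))" for y
    using gauss_twist[OF \<alpha>'(1), of y] \<alpha>' \<alpha> by (simp add: mult.commute)
  have "gauss \<psi> ?\<alpha>' * (\<Sum>x\<in>I \<rightarrow>\<^sub>E UNIV. \<alpha> (1 - (\<Sum>i\<in>I. x i)) * (\<Prod>i\<in>I. \<theta> i (x i))) =
     (\<Sum>x\<in>I \<rightarrow>\<^sub>E UNIV. \<Sum>u\<in>UNIV. - ?\<alpha>' u * \<psi> (u * (1 - (\<Sum>i\<in>I. x i))) * (\<Prod>i\<in>I. \<theta> i (x i)))"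
    unfolding sum_distrib_left mult.assoc[symmetric] \<alpha>y
    by (simp only: sum_distrib_right sum_negf[symmetric] mult_minus_left)
  also have "\<dots> = (\<Sum>x\<in>I \<rightarrow>\<^sub>E UNIV. \<Sum>u\<in>UNIV. - (?\<alpha>' u * \<psi> u) * (\<Prod>i\<in>I. \<theta> i (x i) * \<psi> (x i * (- u))))"
  proof (intro sum.cong refl)
    fix u :: 'k and x :: "'a \<Rightarrow> 'k"
    have "\<psi> (u * (1 - (\<Sum>i\<in>I. x i))) = \<psi> u * (\<Prod>i\<in>I. \<psi> (x i * (- u)))"
      by (simp add: psi_sum[symmetric] psi_add[symmetric] sum_negf sum_distrib_left algebra_simps)
    then show "- ?\<alpha>' u * \<psi> (u * (1 - (\<Sum>i\<in>I. x i))) * (\<Prod>i\<in>I. \<theta> i (x i)) =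
      - (?\<alpha>' u * \<psi> u) * (\<Prod>i\<in>I. \<theta> i (x i) * \<psi> (x i * (- u)))"
      by (simp only: prod.distrib) (simp add: mult_ac)
  qed
  also have "\<dots> = (\<Sum>u\<in>UNIV. - (?\<alpha>' u * \<psi> u) * (\<Sum>x\<in>I \<rightarrow>\<^sub>E UNIV. \<Prod>i\<in>I. \<theta> i (x i) * \<psi> (x i * (- u))))"
    by (subst sum.swap) (simp only: sum_distrib_left)
  also have "\<dots> = (\<Sum>u\<in>UNIV. - (?\<alpha>' u * \<psi> u) * (\<Prod>i\<in>I. \<Sum>x\<in>UNIV. \<theta> i x * \<psi> (x * (- u))))"
    by (subst prod_sum_PiE[OF I]) simp_all
  \<comment> \<open>Dropping \<open>u = 0\<close> makes \<open>gauss_twist\<close> applicable to every \<open>\<theta>\<^sub>i\<close>, trivial or not.\<close>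
  also have "\<dots> = (\<Sum>u | u \<noteq> 0. - (?\<alpha>' u * \<psi> u) * (\<Prod>i\<in>I. \<Sum>x\<in>UNIV. \<theta> i x * \<psi> (x * (- u))))"
    by (rule sum.mono_neutral_right) (use \<alpha> in auto)
  also have "\<dots> = (\<Sum>u | u \<noteq> 0. (\<Prod>i\<in>I. - \<theta> i (-1) * gauss \<psi> (\<theta> i)) *
      - (\<psi> u * (inv\<^bsub>char_group\<^esub> (\<alpha> \<otimes>\<^bsub>char_group\<^esub> (\<Otimes>\<^bsub>char_group\<^esub>i\<in>I. \<theta> i))) u))"
  proof (intro sum.cong refl)
    fix u :: 'k assume "u \<in> {u. u \<noteq> 0}"
    then have u: "u \<noteq> 0" by simp
    have "(\<Sum>x\<in>UNIV. \<theta> i x * \<psi> (x * (- u))) = - \<theta> i (-1) * gauss \<psi> (\<theta> i) * inverse (\<theta> i u)"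
      if "i \<in> I" for i
      using gauss_twist[OF \<theta>[OF that], of "- u"] u char_mult[OF \<theta>[OF that], of "-1" u]
        inverse_unique[OF char_minus_one_sq[OF \<theta>[OF that]]]
      by simp
    then have "(\<Prod>i\<in>I. \<Sum>x\<in>UNIV. \<theta> i x * \<psi> (x * (- u))) =
        (\<Prod>i\<in>I. - \<theta> i (-1) * gauss \<psi> (\<theta> i)) * inverse (\<Prod>i\<in>I. \<theta> i u)"
      by (simp only: prod.distrib[symmetric] prod_inversef[symmetric] o_def cong: prod.cong)
    moreover have "(\<Otimes>\<^bsub>char_group\<^esub>i\<in>I. \<theta> i) u = (\<Prod>i\<in>I. \<theta> i u)"
      using u I \<theta> by (intro char_finprod_apply) auto
    moreover have "(\<Otimes>\<^bsub>char_group\<^esub>i\<in>I. \<theta> i) \<in> mult_chars"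
      using chars.finprod_closed[of \<theta> I] \<theta> by auto
    ultimately show "- (?\<alpha>' u * \<psi> u) * (\<Prod>i\<in>I. \<Sum>x\<in>UNIV. \<theta> i x * \<psi> (x * (- u))) =
       (\<Prod>i\<in>I. - \<theta> i (-1) * gauss \<psi> (\<theta> i)) *
      - (\<psi> u * (inv\<^bsub>char_group\<^esub> (\<alpha> \<otimes>\<^bsub>char_group\<^esub> (\<Otimes>\<^bsub>char_group\<^esub>i\<in>I. \<theta> i))) u)"
      using \<alpha> by (simp add: mult_ac)
  qed
  also have "\<dots> = (\<Prod>i\<in>I. - \<theta> i (-1) * gauss \<psi> (\<theta> i)) *
      gauss \<psi> (inv\<^bsub>char_group\<^esub> (\<alpha> \<otimes>\<^bsub>char_group\<^esub> (\<Otimes>\<^bsub>char_group\<^esub>i\<in>I. \<theta> i)))"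
    by (simp only: gauss_def sum_distrib_left[symmetric] sum_negf)
  finally show ?thesis .
qed

text \<open>The first coordinate is eliminated through \<open>x\<^sub>0 = 1 - x\<^sub>1 - \<dots> - x\<^sub>n\<close>.  The points with a zero
  coordinate can be put back, since characters vanish at \<open>0\<close>.\<close>

lemma jacobi_eq_simplex_sum:
  fixes \<alpha> :: "'k \<Rightarrow> qbar"
  assumes \<alpha>: "\<alpha> \<in> mult_chars" and \<theta>: "\<And>i. \<theta> i \<in> mult_chars"
  shows "jacobi (\<alpha> # map \<theta> [1..<Suc n]) =
    (-1) ^ n * (\<Sum>x\<in>{1..n} \<rightarrow>\<^sub>E UNIV. \<alpha> (1 - (\<Sum>i\<in>{1..n}. x i)) * (\<Prod>i\<in>{1..n}. \<theta> i (x i)))"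
proof -
  let ?\<eta>s = "\<alpha> # map \<theta> [1..<Suc n]"
  let ?h = "\<lambda>x::nat \<Rightarrow> 'k. (1 - (\<Sum>i\<in>{1..n}. x i)) # map x [1..<Suc n]"
  have len: "length ?\<eta>s = Suc n" by simp
  have val: "(\<Prod>i<Suc n. (?\<eta>s ! i) (?h x ! i)) = \<alpha> (1 - (\<Sum>i\<in>{1..n}. x i)) * (\<Prod>i\<in>{1..n}. \<theta> i (x i))" for x
  proof -
    have "(\<Prod>i<Suc n. (?\<eta>s ! i) (?h x ! i)) =
        (?\<eta>s ! 0) (?h x ! 0) * (\<Prod>i<n. (?\<eta>s ! Suc i) (?h x ! Suc i))"
      by (rule prod.lessThan_Suc_shift)
    also have "(\<Prod>i<n. (?\<eta>s ! Suc i) (?h x ! Suc i)) = (\<Prod>i<n. \<theta> (Suc i) (x (Suc i)))"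
      by (intro prod.cong) (auto simp del: upt_Suc)
    also have "\<dots> = (\<Prod>i\<in>{1..n}. \<theta> i (x i))"
      by (rule prod.reindex_bij_witness[of _ "\<lambda>i. i - 1" Suc]) auto
    finally show ?thesis by simp
  qed
  have sl: "(\<Sum>i\<leftarrow>[1..<Suc n]. x i) = (\<Sum>i\<in>{1..n}. x i)" for x :: "nat \<Rightarrow> 'k"
    by (subst sum_list_distinct_conv_sum_set) (auto simp: atLeastLessThanSuc_atLeastAtMost simp del: upt_Suc)
  have "(\<Sum>xs | length xs = Suc n \<and> sum_list xs = 1. \<Prod>i<Suc n. (?\<eta>s ! i) (xs ! i)) =
      (\<Sum>x\<in>{1..n} \<rightarrow>\<^sub>E UNIV. \<Prod>i<Suc n. (?\<eta>s ! i) (?h x ! i))"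
  proof (rule sum.reindex_bij_witness[of _ ?h "\<lambda>xs. \<lambda>i\<in>{1..n}. xs ! i"])
    fix xs :: "'k list" assume xs: "xs \<in> {xs. length xs = Suc n \<and> sum_list xs = 1}"
    then obtain y ys where ys: "xs = y # ys" "length ys = n" by (cases xs) auto
    have "map (\<lambda>i\<in>{1..n}. xs ! i) [1..<Suc n] = ys"
      using ys by (intro nth_equalityI) (auto simp del: upt_Suc)
    moreover then have "(\<Sum>i\<in>{1..n}. (\<lambda>i\<in>{1..n}. xs ! i) i) = sum_list ys"
      using sl[of "\<lambda>i\<in>{1..n}. xs ! i"] by metis
    ultimately show "?h (\<lambda>i\<in>{1..n}. xs ! i) = xs" 
      using xs ys by (simp only: list.inject) (auto simp: algebra_simps)
    then show "(\<Prod>i<Suc n. (?\<eta>s ! i) (?h (\<lambda>i\<in>{1..n}. xs ! i) ! i)) = (\<Prod>i<Suc n. (?\<eta>s ! i) (xs ! i))"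
      by (simp only:)
  next
    fix x :: "nat \<Rightarrow> 'k" assume x: "x \<in> {1..n} \<rightarrow>\<^sub>E UNIV"
    show "(\<lambda>i\<in>{1..n}. ?h x ! i) = x"
      using x by (intro extensionalityI[of _ "{1..n}"]) (auto simp: nth_Cons' PiE_iff simp del: upt_Suc)
    show "?h x \<in> {xs. length xs = Suc n \<and> sum_list xs = 1}"
      using sl[of x] by (simp del: upt_Suc)
  qed auto
  moreover have "(\<Sum>xs | length xs = Suc n \<and> 0 \<notin> set xs \<and> sum_list xs = 1. \<Prod>i<Suc n. (?\<eta>s ! i) (xs ! i)) =
    (\<Sum>xs | length xs = Suc n \<and> sum_list xs = 1. \<Prod>i<Suc n. (?\<eta>s ! i) (xs ! i))"
  proof (rule sum.mono_neutral_left)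
    have "finite {xs::'k list. set xs \<subseteq> UNIV \<and> length xs = Suc n}" by (rule finite_lists_length_eq) simp
    then show "finite {xs::'k list. length xs = Suc n \<and> sum_list xs = 1}"
      by (rule rev_finite_subset) auto
    have mem: "?\<eta>s ! i \<in> mult_chars" if "i < Suc n" for i
      using that \<alpha> \<theta> by (cases i) (auto simp del: upt_Suc)
    show "\<forall>xs\<in>{xs. length xs = Suc n \<and> sum_list xs = 1} -
        {xs. length xs = Suc n \<and> 0 \<notin> set xs \<and> sum_list xs = 1}. (\<Prod>i<Suc n. (?\<eta>s ! i) (xs ! i)) = 0"
    proof
      fix xs :: "'k list"
      assume "xs \<in> {xs. length xs = Suc n \<and> sum_list xs = 1} -
        {xs. length xs = Suc n \<and> 0 \<notin> set xs \<and> sum_list xs = 1}"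
      then obtain i where i: "i < Suc n" "xs ! i = 0" by (auto simp: in_set_conv_nth)
      then have "(?\<eta>s ! i) (xs ! i) = 0" using char_0[OF mem] by (simp only:)
      then show "(\<Prod>i<Suc n. (?\<eta>s ! i) (xs ! i)) = 0" using i(1) by (intro prod_zero) auto
    qed
  qed auto
  ultimately show ?thesis unfolding jacobi_def len val by simp
qed

lemma jacobi_two:
  fixes \<alpha> :: "'k \<Rightarrow> qbar"
  assumes "\<alpha> \<in> mult_chars" "\<beta> \<in> mult_chars"
  shows "- jacobi [\<alpha>, \<beta>] = (\<Sum>x\<in>UNIV. \<alpha> x * \<beta> (1 - x))"
proof -
  have "jacobi [\<alpha>, \<beta>] = - (\<Sum>x\<in>{1} \<rightarrow>\<^sub>E UNIV. \<alpha> (1 - x (1::nat)) * \<beta> (x 1))"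
    using jacobi_eq_simplex_sum[of \<alpha> "\<lambda>_. \<beta>" 1] assms by simp
  also have "\<dots> = - (\<Sum>x\<in>UNIV. \<alpha> (1 - x) * \<beta> x)"
    by (subst sum_PiE_singleton) simp
  also have "(\<Sum>x\<in>UNIV. \<alpha> (1 - x) * \<beta> x) = (\<Sum>x\<in>UNIV. \<alpha> x * \<beta> (1 - x))"
    by (rule sum.reindex_bij_witness[of _ "\<lambda>x. 1 - x" "\<lambda>x. 1 - x"]) auto
  finally show ?thesis by simp
qed

lemma jacobi_two_gauss:
  assumes \<alpha>: "\<alpha> \<in> mult_chars" and \<beta>: "\<beta> \<in> mult_chars" "\<beta> \<noteq> \<one>\<^bsub>char_group\<^esub>"
  shows "gauss \<psi> (inv\<^bsub>char_group\<^esub> \<beta>) * - jacobi [\<alpha>, \<beta>] =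
    - (\<alpha> (-1) * gauss \<psi> \<alpha> * gauss \<psi> (inv\<^bsub>char_group\<^esub> (\<alpha> \<otimes>\<^bsub>char_group\<^esub> \<beta>)))"
proof -
  have "(\<Sum>x\<in>UNIV. \<alpha> x * \<beta> (1 - x)) = (\<Sum>x\<in>{0::nat} \<rightarrow>\<^sub>E UNIV. \<beta> (1 - x 0) * \<alpha> (x 0))"
    by (subst sum_PiE_singleton) (simp add: mult.commute)
  moreover have "\<alpha> \<otimes>\<^bsub>char_group\<^esub> \<beta> = \<beta> \<otimes>\<^bsub>char_group\<^esub> \<alpha>" by (rule ext) simp
  ultimately show ?thesis
    using simplex_sum_gauss[of "{0::nat}" \<beta> "\<lambda>_. \<alpha>"] \<alpha> \<beta> by (simp add: jacobi_two)
qed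

section \<open>Integral representations of the Lauricella function\<close>

lemma finprod_chars_closed [simp]:
  "(\<And>i. i \<in> I \<Longrightarrow> \<nu> i \<in> mult_chars) \<Longrightarrow> (\<Otimes>\<^bsub>char_group\<^esub>i\<in>I. \<nu> i) \<in> (mult_chars :: ('k \<Rightarrow> qbar) set)"
  using chars.finprod_closed[of \<nu> I] by auto

lemma lauricella_A_eq:
  "lauricella_A \<psi> n \<alpha> \<beta> \<gamma> l = 1 / (1 - of_nat CARD('k)) ^ n *
     (\<Sum>\<nu>\<in>{1..n} \<rightarrow>\<^sub>E mult_chars. poch \<psi> \<alpha> (\<Otimes>\<^bsub>char_group\<^esub>i\<in>{1..n}. \<nu> i) *
        (\<Prod>i\<in>{1..n}. poch \<psi> (\<beta> i) (\<nu> i) / poch_circ \<psi> (\<gamma> i) (\<nu> i) *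
            (\<nu> i (l i) / poch_circ \<psi> \<one>\<^bsub>char_group\<^esub> (\<nu> i))))"
  unfolding lauricella_A_def carrier_char_group
  by (rule arg_cong2[where f = "(*)"], rule refl, rule sum.cong, rule refl)
    (simp only: prod.distrib divide_inverse prod_inversef[symmetric] o_def inverse_mult_distrib mult_ac)

text \<open>The quotient of Pochhammer symbols is exactly what turns \<open>j(\<beta>, \<gamma>)\<close> into \<open>j(\<beta>\<nu>, \<gamma>)\<close>.\<close>

lemma jacobi_two_shift:
  assumes \<beta>: "\<beta> \<in> mult_chars" and \<gamma>: "\<gamma> \<in> mult_chars" "\<gamma> \<noteq> \<one>\<^bsub>char_group\<^esub>" and \<nu>: "\<nu> \<in> mult_chars"
  shows "- jacobi [\<beta>, \<gamma>] * (poch \<psi> \<beta> \<nu> / poch_circ \<psi> (\<beta> \<otimes>\<^bsub>char_group\<^esub> \<gamma>) \<nu>) =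
    (\<Sum>x\<in>UNIV. \<beta> x * \<gamma> (1 - x) * \<nu> x)"
proof -
  let ?g = "gauss \<psi>" and ?\<beta>\<gamma> = "\<beta> \<otimes>\<^bsub>char_group\<^esub> \<gamma>" and ?\<beta>\<nu> = "\<beta> \<otimes>\<^bsub>char_group\<^esub> \<nu>"
  have closed: "?\<beta>\<nu> \<in> mult_chars" "?\<beta>\<gamma> \<in> mult_chars" using assms by auto
  have assoc: "?\<beta>\<gamma> \<otimes>\<^bsub>char_group\<^esub> \<nu> = ?\<beta>\<nu> \<otimes>\<^bsub>char_group\<^esub> \<gamma>" by (rule ext) simp
  have sum: "(\<Sum>x\<in>UNIV. \<beta> x * \<gamma> (1 - x) * \<nu> x) = - jacobi [?\<beta>\<nu>, \<gamma>]"
    unfolding jacobi_two[OF closed(1) \<gamma>(1)] by (simp add: mult_ac)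
  have nz: "?g (inv\<^bsub>char_group\<^esub> \<gamma>) \<noteq> 0" "?g \<beta> \<noteq> 0" "?g (inv\<^bsub>char_group\<^esub> ?\<beta>\<gamma>) \<noteq> 0"
    using assms closed by (auto intro!: gauss_neq_0)
  have "?g (inv\<^bsub>char_group\<^esub> \<gamma>) * (- jacobi [\<beta>, \<gamma>] * (poch \<psi> \<beta> \<nu> / poch_circ \<psi> ?\<beta>\<gamma> \<nu>)) =
      (?g (inv\<^bsub>char_group\<^esub> \<gamma>) * - jacobi [\<beta>, \<gamma>]) * (poch \<psi> \<beta> \<nu> * inverse (poch_circ \<psi> ?\<beta>\<gamma> \<nu>))"
    by (simp add: divide_inverse mult_ac)
  also have "\<dots> = ?g (inv\<^bsub>char_group\<^esub> \<gamma>) * - jacobi [?\<beta>\<nu>, \<gamma>]"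
    unfolding jacobi_two_gauss[OF \<beta> \<gamma>] jacobi_two_gauss[OF closed(1) \<gamma>]
      inverse_poch_circ[OF closed(2) \<nu>] assoc poch_def
    using nz by (simp add: field_simps)
  finally show ?thesis unfolding sum mult_left_cancel[OF nz(1)] .
qed

text \<open>The analogue of the Euler integral over the unit cube.  The binomial theorem requires
  \<open>\<lambda>\<^sub>i x\<^sub>i \<noteq> 0\<close>, but points with some \<open>x\<^sub>i = 0\<close> do not contribute, because \<open>B\<^sub>i(0) = 0\<close> even for a trivial
  \<open>B\<^sub>i\<close>.\<close>

lemma lauricella_A_integral_cube:
  assumes A: "A \<in> mult_chars" "A \<noteq> \<one>\<^bsub>char_group\<^esub>"
    and B: "\<And>i. B i \<in> mult_chars" and C: "\<And>i. C i \<in> mult_chars"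
    and C1: "\<And>i. i \<in> {1..n} \<Longrightarrow> C i \<noteq> \<one>\<^bsub>char_group\<^esub>"
    and l: "\<And>i. i \<in> {1..n} \<Longrightarrow> l i \<noteq> 0"
  shows "(\<Sum>x\<in>{1..n} \<rightarrow>\<^sub>E UNIV. A (1 - (\<Sum>i\<in>{1..n}. l i * x i)) *
            (\<Prod>i\<in>{1..n}. B i (x i) * C i (1 - x i))) =
    (\<Prod>i\<in>{1..n}. - jacobi [B i, C i]) *
      lauricella_A \<psi> n (inv\<^bsub>char_group\<^esub> A) B (\<lambda>i. B i \<otimes>\<^bsub>char_group\<^esub> C i) l"
proof -
  let ?I = "{1..n}"
  let ?P = "\<lambda>\<nu>. poch \<psi> (inv\<^bsub>char_group\<^esub> A) (\<Otimes>\<^bsub>char_group\<^esub>i\<in>?I. \<nu> i)"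
  let ?e = "\<lambda>\<nu>. poch_circ \<psi> \<one>\<^bsub>char_group\<^esub> \<nu>"
  let ?BC = "\<lambda>x. \<Prod>i\<in>?I. B i (x i) * C i (1 - x i)"
  let ?Q = "(1 - of_nat CARD('k)) ^ n :: qbar"
  have "(\<Prod>i\<in>?I. - jacobi [B i, C i]) * (\<Prod>i\<in>?I. poch \<psi> (B i) (\<nu> i) /
           poch_circ \<psi> (B i \<otimes>\<^bsub>char_group\<^esub> C i) (\<nu> i) * (\<nu> i (l i) / ?e (\<nu> i))) =
      (\<Sum>x\<in>?I \<rightarrow>\<^sub>E UNIV. ?BC x * (\<Prod>i\<in>?I. \<nu> i (l i * x i) / ?e (\<nu> i)))"
    if \<nu>: "\<nu> \<in> ?I \<rightarrow>\<^sub>E mult_chars" for \<nu>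
  proof -
    have \<nu>i: "\<nu> i \<in> mult_chars" if "i \<in> ?I" for i using \<nu> that by auto
    have "(\<Prod>i\<in>?I. - jacobi [B i, C i]) * (\<Prod>i\<in>?I. poch \<psi> (B i) (\<nu> i) /
           poch_circ \<psi> (B i \<otimes>\<^bsub>char_group\<^esub> C i) (\<nu> i) * (\<nu> i (l i) / ?e (\<nu> i))) =
       (\<Prod>i\<in>?I. (\<Sum>x\<in>UNIV. B i x * C i (1 - x) * \<nu> i x) * (\<nu> i (l i) / ?e (\<nu> i)))"
      unfolding prod.distrib[symmetric] mult.assoc[symmetric]
      by (intro prod.cong refl arg_cong2[where f = "(*)"])
        (use \<nu>i B C C1 jacobi_two_shift in auto)
    also have "\<dots> = (\<Prod>i\<in>?I. \<Sum>x\<in>UNIV. B i x * C i (1 - x) * (\<nu> i (l i * x) / ?e (\<nu> i)))"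
      using \<nu>i by (intro prod.cong refl) 
        (simp add: sum_distrib_right sum_distrib_left char_mult divide_inverse mult_ac)
    also have "\<dots> = (\<Sum>x\<in>?I \<rightarrow>\<^sub>E UNIV. \<Prod>i\<in>?I. B i (x i) * C i (1 - x i) * (\<nu> i (l i * x i) / ?e (\<nu> i)))"
      by (rule prod_sum_PiE) auto
    finally show ?thesis unfolding prod.distrib .
  qed
  note inner = this
  have "(\<Prod>i\<in>?I. - jacobi [B i, C i]) *
      lauricella_A \<psi> n (inv\<^bsub>char_group\<^esub> A) B (\<lambda>i. B i \<otimes>\<^bsub>char_group\<^esub> C i) l =
      1 / ?Q * (\<Sum>\<nu>\<in>?I \<rightarrow>\<^sub>E mult_chars. ?P \<nu> * ((\<Prod>i\<in>?I. - jacobi [B i, C i]) *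
        (\<Prod>i\<in>?I. poch \<psi> (B i) (\<nu> i) / poch_circ \<psi> (B i \<otimes>\<^bsub>char_group\<^esub> C i) (\<nu> i) *
            (\<nu> i (l i) / ?e (\<nu> i)))))"
    unfolding lauricella_A_eq
    by (simp only: mult.left_commute[of "\<Prod>i\<in>?I. - jacobi [B i, C i]"] sum_distrib_left)
  also have "\<dots> = 1 / ?Q * (\<Sum>\<nu>\<in>?I \<rightarrow>\<^sub>E mult_chars. ?P \<nu> *
      (\<Sum>x\<in>?I \<rightarrow>\<^sub>E UNIV. ?BC x * (\<Prod>i\<in>?I. \<nu> i (l i * x i) / ?e (\<nu> i))))"
    by (simp only: inner cong: sum.cong)
  also have "\<dots> = 1 / ?Q * (\<Sum>x\<in>?I \<rightarrow>\<^sub>E UNIV. ?BC x * (\<Sum>\<nu>\<in>?I \<rightarrow>\<^sub>E mult_chars. ?P \<nu> *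
      (\<Prod>i\<in>?I. \<nu> i (l i * x i) / ?e (\<nu> i))))"
    unfolding sum_distrib_left by (subst sum.swap) (simp only: mult_ac)
  also have "\<dots> = 1 / ?Q * (\<Sum>x\<in>?I \<rightarrow>\<^sub>E UNIV. ?BC x * (?Q * A (1 - (\<Sum>i\<in>?I. l i * x i))))"
  proof (rule arg_cong2[where f = "(*)"], rule refl, rule sum.cong, rule refl)
    fix x :: "nat \<Rightarrow> 'k"
    show "?BC x * (\<Sum>\<nu>\<in>?I \<rightarrow>\<^sub>E mult_chars. ?P \<nu> * (\<Prod>i\<in>?I. \<nu> i (l i * x i) / ?e (\<nu> i))) =
      ?BC x * (?Q * A (1 - (\<Sum>i\<in>?I. l i * x i)))"
    proof (cases "\<exists>i\<in>?I. x i = 0")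
      case True
      then obtain i where "i \<in> ?I" "x i = 0" by blast
      then have "?BC x = 0" using B by (intro prod_zero bexI[of _ i]) auto
      then show ?thesis by simp
    next
      case False
      then show ?thesis
        using binomial_theorem[of ?I "inv\<^bsub>char_group\<^esub> A" "\<lambda>i. l i * x i"] A l
        by (simp add: char_inv_eq_one_iff)
    qed
  qed
  also have "\<dots> = (\<Sum>x\<in>?I \<rightarrow>\<^sub>E UNIV. A (1 - (\<Sum>i\<in>?I. l i * x i)) * ?BC x)"
    by (simp add: sum_distrib_left mult_ac)
  finally show ?thesis by (rule sym)
qed

text \<open>Both sides are products of Gauss sums by \<open>simplex_sum_gauss\<close>.  Replacing \<open>\<theta>\<^sub>i\<close> by
  \<open>\<theta>\<^sub>i\<nu>\<^sub>i\<^sup>-\<^sup>1\<close> divides the factor of index \<open>i\<close> by a Pochhammer symbol of \<open>\<theta>\<^sub>i\<^sup>-\<^sup>1\<close> with \<open>\<circ>\<close>, by the reflection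
  formula, and multiplies the last factor by a Pochhammer symbol without \<open>\<circ>\<close>.\<close>

lemma simplex_sum_shift:
  fixes I :: "'i set"
  assumes I: "finite I" and A: "A \<in> mult_chars" "A \<noteq> \<one>\<^bsub>char_group\<^esub>"
    and \<theta>: "\<And>i. i \<in> I \<Longrightarrow> \<theta> i \<in> mult_chars" and \<nu>: "\<And>i. i \<in> I \<Longrightarrow> \<nu> i \<in> mult_chars"
  defines "T \<equiv> \<lambda>\<theta>. \<Sum>x\<in>I \<rightarrow>\<^sub>E UNIV. A (1 - (\<Sum>i\<in>I. x i)) * (\<Prod>i\<in>I. \<theta> i (x i))"
  shows "T (\<lambda>i. \<theta> i \<otimes>\<^bsub>char_group\<^esub> inv\<^bsub>char_group\<^esub> (\<nu> i)) = T \<theta> *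
     (poch \<psi> (inv\<^bsub>char_group\<^esub> (A \<otimes>\<^bsub>char_group\<^esub> (\<Otimes>\<^bsub>char_group\<^esub>i\<in>I. \<theta> i))) (\<Otimes>\<^bsub>char_group\<^esub>i\<in>I. \<nu> i) *
      (\<Prod>i\<in>I. inverse (poch_circ \<psi> (inv\<^bsub>char_group\<^esub> (\<theta> i)) (\<nu> i))))"
proof -
  let ?g = "gauss \<psi>"
  let ?\<theta>' = "\<lambda>i. \<theta> i \<otimes>\<^bsub>char_group\<^esub> inv\<^bsub>char_group\<^esub> (\<nu> i)"
  let ?\<alpha> = "inv\<^bsub>char_group\<^esub> (A \<otimes>\<^bsub>char_group\<^esub> (\<Otimes>\<^bsub>char_group\<^esub>i\<in>I. \<theta> i))"
  have \<theta>': "?\<theta>' i \<in> mult_chars" if "i \<in> I" for i using \<theta> \<nu> that by simp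
  have \<alpha>: "inv\<^bsub>char_group\<^esub> (A \<otimes>\<^bsub>char_group\<^esub> (\<Otimes>\<^bsub>char_group\<^esub>i\<in>I. ?\<theta>' i)) =
      ?\<alpha> \<otimes>\<^bsub>char_group\<^esub> (\<Otimes>\<^bsub>char_group\<^esub>i\<in>I. \<nu> i)"
  proof (rule char_eqI)
    fix u :: 'k assume u: "u \<noteq> 0"
    have fin: "(\<Otimes>\<^bsub>char_group\<^esub>i\<in>I. \<eta> i) u = (\<Prod>i\<in>I. \<eta> i u)"
      if "\<And>i. i \<in> I \<Longrightarrow> \<eta> i \<in> mult_chars" for \<eta>
      using u I that by (intro char_finprod_apply) auto
    have prod_inv: "(\<Prod>i\<in>I. inverse (\<nu> i u)) = inverse (\<Prod>i\<in>I. \<nu> i u)"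
      using prod_inversef[of "\<lambda>i. \<nu> i u" I] by (simp add: o_def)
    have "(\<Prod>i\<in>I. ?\<theta>' i u) = (\<Prod>i\<in>I. \<theta> i u) * inverse (\<Prod>i\<in>I. \<nu> i u)"
      using \<nu> by (simp add: prod.distrib prod_inv)
    then show "(inv\<^bsub>char_group\<^esub> (A \<otimes>\<^bsub>char_group\<^esub> (\<Otimes>\<^bsub>char_group\<^esub>i\<in>I. ?\<theta>' i))) u =
      (?\<alpha> \<otimes>\<^bsub>char_group\<^esub> (\<Otimes>\<^bsub>char_group\<^esub>i\<in>I. \<nu> i)) u"
      using A \<theta> \<nu> \<theta>' by (simp add: fin prod.distrib prod_inv)
  qed (use A \<theta> \<nu> in auto)
  have factor: "- ?\<theta>' i (-1) * ?g (?\<theta>' i) = (- \<theta> i (-1) * ?g (\<theta> i)) *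
      inverse (poch_circ \<psi> (inv\<^bsub>char_group\<^esub> (\<theta> i)) (\<nu> i))" if i: "i \<in> I" for i
  proof -
    have "inv\<^bsub>char_group\<^esub> (inv\<^bsub>char_group\<^esub> (\<theta> i) \<otimes>\<^bsub>char_group\<^esub> \<nu> i) = ?\<theta>' i"
      by (rule char_eqI) (use \<theta>[OF i] \<nu>[OF i] in auto)
    then show ?thesis
      using \<theta>[OF i] \<nu>[OF i] gauss_neq_0[OF \<theta>[OF i]] inverse_unique[OF char_minus_one_sq[OF \<nu>[OF i]]]
      by (simp add: inverse_poch_circ char_inv_inv)
  qed
  have nz: "?g (inv\<^bsub>char_group\<^esub> A) \<noteq> 0" "?g ?\<alpha> \<noteq> 0"
    using A \<theta> by (auto intro!: gauss_neq_0)
  have "?g (inv\<^bsub>char_group\<^esub> A) * T ?\<theta>' =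
      (\<Prod>i\<in>I. - ?\<theta>' i (-1) * ?g (?\<theta>' i)) * ?g (?\<alpha> \<otimes>\<^bsub>char_group\<^esub> (\<Otimes>\<^bsub>char_group\<^esub>i\<in>I. \<nu> i))"
    unfolding T_def using simplex_sum_gauss[where \<theta> = ?\<theta>', OF I A \<theta>'] unfolding \<alpha> .
  also have "(\<Prod>i\<in>I. - ?\<theta>' i (-1) * ?g (?\<theta>' i)) = (\<Prod>i\<in>I. - \<theta> i (-1) * ?g (\<theta> i)) *
      (\<Prod>i\<in>I. inverse (poch_circ \<psi> (inv\<^bsub>char_group\<^esub> (\<theta> i)) (\<nu> i)))"
    unfolding prod.distrib[symmetric] by (intro prod.cong refl factor[unfolded mult.assoc] factor)
  also have "?g (?\<alpha> \<otimes>\<^bsub>char_group\<^esub> (\<Otimes>\<^bsub>char_group\<^esub>i\<in>I. \<nu> i)) =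
      ?g ?\<alpha> * poch \<psi> ?\<alpha> (\<Otimes>\<^bsub>char_group\<^esub>i\<in>I. \<nu> i)"
    using nz by (simp add: poch_def)
  finally have "?g (inv\<^bsub>char_group\<^esub> A) * T ?\<theta>' = (\<Prod>i\<in>I. - \<theta> i (-1) * ?g (\<theta> i)) * ?g ?\<alpha> *
      (poch \<psi> ?\<alpha> (\<Otimes>\<^bsub>char_group\<^esub>i\<in>I. \<nu> i) *
      (\<Prod>i\<in>I. inverse (poch_circ \<psi> (inv\<^bsub>char_group\<^esub> (\<theta> i)) (\<nu> i))))"
    by (simp only: mult_ac)
  also have "(\<Prod>i\<in>I. - \<theta> i (-1) * ?g (\<theta> i)) * ?g ?\<alpha> = ?g (inv\<^bsub>char_group\<^esub> A) * T \<theta>"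
    unfolding T_def using simplex_sum_gauss[where \<theta> = \<theta>, OF I A \<theta>] by (simp only:)
  finally show ?thesis unfolding mult.assoc mult_left_cancel[OF nz(1)] .
qed

text \<open>The analogue of the Euler integral over the standard simplex.  Here
  \<open>B\<^sub>i(x - \<lambda>\<^sub>i) = B\<^sub>i(x) B\<^sub>i(1 - \<lambda>\<^sub>i / x)\<close> is expanded in each variable separately, so that the remaining sum
  over \<open>x\<close> is a Jacobi sum whose characters are shifted by the \<open>\<nu>\<^sub>i\<close>.\<close>

lemma lauricella_A_integral_simplex:
  assumes A: "A \<in> mult_chars" "A \<noteq> \<one>\<^bsub>char_group\<^esub>"
    and B: "\<And>i. B i \<in> mult_chars" and C: "\<And>i. C i \<in> mult_chars"
    and B1: "\<And>i. i \<in> {1..n} \<Longrightarrow> B i \<noteq> \<one>\<^bsub>char_group\<^esub>"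
    and l: "\<And>i. i \<in> {1..n} \<Longrightarrow> l i \<noteq> 0"
  shows "(\<Sum>x\<in>{1..n} \<rightarrow>\<^sub>E UNIV. A (1 - (\<Sum>i\<in>{1..n}. x i)) *
            (\<Prod>i\<in>{1..n}. B i (x i - l i) * C i (x i))) =
    (-1) ^ n * jacobi (A # map (\<lambda>i. B i \<otimes>\<^bsub>char_group\<^esub> C i) [1..<Suc n]) *
      lauricella_A \<psi> n
        (inv\<^bsub>char_group\<^esub> (A \<otimes>\<^bsub>char_group\<^esub> (\<Otimes>\<^bsub>char_group\<^esub>i\<in>{1..n}. B i \<otimes>\<^bsub>char_group\<^esub> C i)))
        (\<lambda>i. inv\<^bsub>char_group\<^esub> (B i)) (\<lambda>i. inv\<^bsub>char_group\<^esub> (B i \<otimes>\<^bsub>char_group\<^esub> C i)) l"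
proof -
  let ?I = "{1..n}"
  let ?\<theta> = "\<lambda>i. B i \<otimes>\<^bsub>char_group\<^esub> C i"
  let ?\<alpha> = "inv\<^bsub>char_group\<^esub> (A \<otimes>\<^bsub>char_group\<^esub> (\<Otimes>\<^bsub>char_group\<^esub>i\<in>?I. ?\<theta> i))"
  let ?e = "\<lambda>\<nu>. poch_circ \<psi> \<one>\<^bsub>char_group\<^esub> \<nu>"
  let ?Q = "(1 - of_nat CARD('k)) ^ n :: qbar"
  let ?r = "\<lambda>i \<nu>. poch \<psi> (inv\<^bsub>char_group\<^esub> (B i)) \<nu> * (\<nu> (l i) / ?e \<nu>)"
  have Q: "?Q \<noteq> 0" by (rule power_not_zero) (rule one_minus_card_neq_0)
  define T where "T \<theta> = (\<Sum>x\<in>?I \<rightarrow>\<^sub>E UNIV. A (1 - (\<Sum>i\<in>?I. x i)) * (\<Prod>i\<in>?I. \<theta> i (x i)))" for \<theta>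
  have expand: "(1 - of_nat CARD('k)) * (B i (x - l i) * C i x) =
      (\<Sum>\<nu>\<in>mult_chars. ?r i \<nu> * (?\<theta> i \<otimes>\<^bsub>char_group\<^esub> inv\<^bsub>char_group\<^esub> \<nu>) x)" if i: "i \<in> ?I" for i x
  proof (cases "x = 0")
    case False
    have "B i (x - l i) = B i x * B i (1 - l i / x)"
      using False by (simp add: char_mult[OF B, symmetric] algebra_simps)
    then have "(1 - of_nat CARD('k)) * (B i (x - l i) * C i x) =
        ?\<theta> i x * ((1 - of_nat CARD('k)) * B i (1 - l i / x))" by simp
    also have "(1 - of_nat CARD('k)) * B i (1 - l i / x) =
       (\<Sum>\<nu>\<in>mult_chars. poch \<psi> (inv\<^bsub>char_group\<^esub> (B i)) \<nu> * (\<nu> (l i / x) / ?e \<nu>))"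
      using False l[OF i] by (intro binomial_theorem_one[symmetric] B B1[OF i]) simp
    also have "?\<theta> i x * \<dots> = (\<Sum>\<nu>\<in>mult_chars. ?r i \<nu> * (?\<theta> i \<otimes>\<^bsub>char_group\<^esub> inv\<^bsub>char_group\<^esub> \<nu>) x)"
      unfolding sum_distrib_left by (intro sum.cong refl) (simp add: char_divide field_simps)
    finally show ?thesis .
  qed (use C in simp)
  have "?Q * (\<Sum>x\<in>?I \<rightarrow>\<^sub>E UNIV. A (1 - (\<Sum>i\<in>?I. x i)) * (\<Prod>i\<in>?I. B i (x i - l i) * C i (x i))) =
     (\<Sum>x\<in>?I \<rightarrow>\<^sub>E UNIV. A (1 - (\<Sum>i\<in>?I. x i)) *
        (\<Prod>i\<in>?I. (1 - of_nat CARD('k)) * (B i (x i - l i) * C i (x i))))"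
    by (simp add: sum_distrib_left prod.distrib mult_ac)
  also have "\<dots> = (\<Sum>x\<in>?I \<rightarrow>\<^sub>E UNIV. A (1 - (\<Sum>i\<in>?I. x i)) *
      (\<Prod>i\<in>?I. \<Sum>\<nu>\<in>mult_chars. ?r i \<nu> * (?\<theta> i \<otimes>\<^bsub>char_group\<^esub> inv\<^bsub>char_group\<^esub> \<nu>) (x i)))"
    by (simp only: expand cong: prod.cong)
  also have "\<dots> = (\<Sum>x\<in>?I \<rightarrow>\<^sub>E UNIV. A (1 - (\<Sum>i\<in>?I. x i)) * (\<Sum>\<nu>\<in>?I \<rightarrow>\<^sub>E mult_chars.
      (\<Prod>i\<in>?I. ?r i (\<nu> i)) * (\<Prod>i\<in>?I. (?\<theta> i \<otimes>\<^bsub>char_group\<^esub> inv\<^bsub>char_group\<^esub> (\<nu> i)) (x i))))"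
    by (subst prod_sum_PiE) (simp_all only: prod.distrib finite_atLeastAtMost finite_mult_chars)
  also have "\<dots> = (\<Sum>\<nu>\<in>?I \<rightarrow>\<^sub>E mult_chars. (\<Prod>i\<in>?I. ?r i (\<nu> i)) *
      T (\<lambda>i. ?\<theta> i \<otimes>\<^bsub>char_group\<^esub> inv\<^bsub>char_group\<^esub> (\<nu> i)))"
    unfolding T_def sum_distrib_left by (subst sum.swap) (simp only: mult_ac)
  also have "\<dots> = (\<Sum>\<nu>\<in>?I \<rightarrow>\<^sub>E mult_chars. (\<Prod>i\<in>?I. ?r i (\<nu> i)) * (T ?\<theta> *
     (poch \<psi> ?\<alpha> (\<Otimes>\<^bsub>char_group\<^esub>i\<in>?I. \<nu> i) *
      (\<Prod>i\<in>?I. inverse (poch_circ \<psi> (inv\<^bsub>char_group\<^esub> (?\<theta> i)) (\<nu> i))))))"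
    unfolding T_def
    by (intro sum.cong refl arg_cong2[where f = "(*)"] simplex_sum_shift)
      (use A B C in \<open>auto simp del: char_mult_apply\<close>)
  also have "\<dots> = T ?\<theta> * (\<Sum>\<nu>\<in>?I \<rightarrow>\<^sub>E mult_chars. poch \<psi> ?\<alpha> (\<Otimes>\<^bsub>char_group\<^esub>i\<in>?I. \<nu> i) *
      (\<Prod>i\<in>?I. poch \<psi> (inv\<^bsub>char_group\<^esub> (B i)) (\<nu> i) / poch_circ \<psi> (inv\<^bsub>char_group\<^esub> (?\<theta> i)) (\<nu> i) *
        (\<nu> i (l i) / ?e (\<nu> i))))"
    unfolding sum_distrib_left
    by (intro sum.cong refl) (simp only: prod.distrib divide_inverse mult_ac)
  also have "\<dots> = ?Q * (T ?\<theta> * lauricella_A \<psi> n ?\<alpha> (\<lambda>i. inv\<^bsub>char_group\<^esub> (B i)) (\<lambda>i. inv\<^bsub>char_group\<^esub> (?\<theta> i)) l)"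
  proof -
    have "T ?\<theta> * S = ?Q * (T ?\<theta> * (1 / ?Q * S))" for S
      using Q by (simp add: field_simps)
    then show ?thesis unfolding lauricella_A_eq .
  qed
  also have "T ?\<theta> = (-1) ^ n * jacobi (A # map ?\<theta> [1..<Suc n])"
    unfolding T_def by (subst jacobi_eq_simplex_sum) (use A B C in \<open>simp_all add: flip: mult.assoc power_add\<close>)
  finally show ?thesis unfolding mult_left_cancel[OF Q] .
qed

end

section \<open>Counting points on cyclic covers of affine space\<close>

text \<open>If \<open>\<phi>\<^sup>k = 1\<close>, then every character, hence every \<open>(q-1)\<close>-th root of unity, is killed by \<open>k\<close>, hence
  by the remainder of \<open>k\<close> modulo \<open>q - 1\<close>.  A nonzero remainder would leave too few roots.\<close>

lemma generator_pow_eq_one: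
  fixes \<phi> :: "'k::{field,finite} \<Rightarrow> qbar"
  assumes "generates_chars \<phi>" and k: "\<phi> [^]\<^bsub>char_group\<^esub> (k::int) = \<one>\<^bsub>char_group\<^esub>"
  shows "int (CARD('k) - 1) dvd k"
proof -
  let ?N = "CARD('k) - 1"
  have \<phi>: "\<phi> \<in> mult_chars" and gen: "generate char_group {\<phi>} = mult_chars"
    using assms by (auto simp: generates_chars_def)
  have N: "?N > 0" using card_field_ge_2[where 'k='k] by simp
  have all: "\<nu> [^]\<^bsub>char_group\<^esub> k = \<one>\<^bsub>char_group\<^esub>" if \<nu>: "\<nu> \<in> mult_chars" for \<nu> :: "'k \<Rightarrow> qbar"
  proof -
    obtain j :: int where "\<nu> = \<phi> [^]\<^bsub>char_group\<^esub> j"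
      using \<nu> chars.generate_pow[of \<phi>] \<phi> unfolding gen by auto
    then have "\<nu> [^]\<^bsub>char_group\<^esub> k = (\<phi> [^]\<^bsub>char_group\<^esub> k) [^]\<^bsub>char_group\<^esub> j"
      using chars.int_pow_pow[of \<phi>] \<phi> by (simp add: mult.commute)
    then show ?thesis by (simp add: k)
  qed
  obtain g :: 'k where g: "g \<noteq> 0" "bij_betw (\<lambda>\<nu>. \<nu> g) mult_chars {z::qbar. z ^ ?N = 1}"
    by (rule mult_chars_roots_of_unity)
  define i where "i = nat (k mod int ?N)"
  have i: "int i = k mod int ?N" "i < ?N"
    unfolding i_def using N pos_mod_bound[of "int ?N" k] pos_mod_sign[of "int ?N" k] by linarith+
  have "z ^ i = 1" if z: "z ^ ?N = 1" for z :: qbar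
  proof -
    obtain \<nu> where \<nu>: "\<nu> \<in> mult_chars" "z = \<nu> g"
      using g(2) z unfolding bij_betw_def by blast
    have z0: "z \<noteq> 0" using \<nu> g by (simp add: char_eq_0_iff)
    have "z powi k = 1"
      using fun_cong[OF all[OF \<nu>(1)], of g] \<nu> g by (simp add: char_int_pow_apply)
    also have "k = int ?N * (k div int ?N) + int i" by (simp add: i)
    finally have "(z ^ ?N) powi (k div int ?N) * z ^ i = 1"
      using z0 by (simp only: power_int_add power_int_mult power_int_of_nat simp_thms)
    then show ?thesis by (simp only: z power_int_1_left mult_1)
  qed
  then have "{z::qbar. z ^ ?N = 1} \<subseteq> {z. z ^ i = 1}" by auto
  then have "i = 0"
    using card_mono[OF card_power_eq_le(1), of i "{z::qbar. z ^ ?N = 1}" 1]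
      card_power_eq_le(2)[of i "1::qbar"] card_roots_of_unity_qbar[where 'k='k] i(2) by linarith
  then show ?thesis using i(1) by (auto simp: dvd_eq_mod_eq_0)
qed

lemma char_part_pow_eq_one_iff:
  fixes \<phi> :: "'k::{field,finite} \<Rightarrow> qbar"
  assumes gen: "generates_chars \<phi>" and d: "d dvd CARD('k) - 1"
  shows "char_part \<phi> d [^]\<^bsub>char_group\<^esub> (m::int) = \<one>\<^bsub>char_group\<^esub> \<longleftrightarrow> int d dvd m"
proof -
  have \<phi>: "\<phi> \<in> mult_chars" using gen by (auto simp: generates_chars_def)
  obtain e where e: "CARD('k) - 1 = d * e" using d by blast
  have pos: "d * e > 0" using card_field_ge_2[where 'k='k] e by linarith
  then have part: "char_part \<phi> d [^]\<^bsub>char_group\<^esub> m = \<phi> [^]\<^bsub>char_group\<^esub> (int e * m)" for m :: int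
  proof -
    have "(CARD('k) - 1) div d = e" using pos unfolding e by simp
    then show ?thesis
      using chars.int_pow_pow[of \<phi> "int e" m] \<phi> by (simp only: char_part_def int_pow_int carrier_char_group)
  qed
  have one: "\<phi> [^]\<^bsub>char_group\<^esub> int (d * e) = \<one>\<^bsub>char_group\<^esub>"
    using \<phi> finite_field_power_eq_1[where 'k='k, unfolded e]
    by (intro char_eqI) (auto simp: int_pow_int char_nat_pow_apply char_power[symmetric] simp del: of_nat_mult)
  show ?thesis
  proof
    assume "char_part \<phi> d [^]\<^bsub>char_group\<^esub> m = \<one>\<^bsub>char_group\<^esub>"
    then have "int (d * e) dvd int e * m" using generator_pow_eq_one[OF gen] by (simp only: part e)
    then show "int d dvd m" using pos by simp
  next
    assume "int d dvd m"
    then obtain j where "m = int d * j" by blast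
    then have "char_part \<phi> d [^]\<^bsub>char_group\<^esub> m = \<phi> [^]\<^bsub>char_group\<^esub> (int (d * e) * j)"
      by (simp add: part mult_ac)
    also have "\<dots> = \<one>\<^bsub>char_group\<^esub>"
      using chars.int_pow_pow[of \<phi> "int (d * e)" j] \<phi> one by simp
    finally show "char_part \<phi> d [^]\<^bsub>char_group\<^esub> m = \<one>\<^bsub>char_group\<^esub>" .
  qed
qed

lemma char_part_closed [simp]: "\<phi> \<in> mult_chars \<Longrightarrow> char_part \<phi> d \<in> mult_chars"
  by (simp add: char_part_def)

lemma char_part_pow_apply:
  fixes \<phi> :: "'k::{field,finite} \<Rightarrow> qbar"
  assumes "\<phi> \<in> mult_chars" "x \<noteq> 0"
  shows "(char_part \<phi> d [^]\<^bsub>char_group\<^esub> (m::int)) x = \<phi> (x ^ ((CARD('k) - 1) div d)) powi m"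
  using assms char_int_pow_apply[OF char_part_closed[OF assms(1)]]
  by (simp add: char_part_def char_nat_pow_apply char_power)

text \<open>The characteristic divides \<open>q\<close>, so it cannot divide a divisor of \<open>q - 1\<close>.\<close>

lemma of_nat_neq_0_closure:
  assumes "d dvd CARD('k::{field,finite}) - 1"
  shows "(of_nat d :: 'k alg_closure) \<noteq> 0"
proof
  assume "(of_nat d :: 'k alg_closure) = 0"
  moreover obtain e where "CARD('k) - 1 = d * e" using assms by blast
  ultimately have "(of_nat (CARD('k) - 1) :: 'k alg_closure) = 0" by simp
  moreover have "(of_nat CARD('k) :: 'k alg_closure) = 0"
    using of_nat_card_eq_0[where 'k='k] by (metis to_ac_0 to_ac_of_nat)
  ultimately show False using card_field_ge_2[where 'k='k] by (simp add: of_nat_diff)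
qed

text \<open>The \<open>d\<close>-th roots of unity in the closure are fixed by the Frobenius and thus rational.\<close>

lemma card_roots_of_unity:
  assumes d: "d dvd CARD('k::{field,finite}) - 1"
  shows "card {\<xi>::'k. \<xi> ^ d = 1} = d"
proof -
  obtain e where e: "CARD('k) - 1 = d * e" using d by blast
  have "{y::'k alg_closure. y ^ d = 1} = to_ac ` {\<xi>. \<xi> ^ d = 1}"
  proof (intro equalityI subsetI)
    fix y :: "'k alg_closure" assume "y \<in> {y. y ^ d = 1}"
    then have y: "y ^ d = 1" by simp
    have "CARD('k) = Suc (d * e)" using e card_field_ge_2[where 'k='k] by simp
    then have "y ^ CARD('k) = y" using y by (simp add: power_mult)
    then obtain \<xi> where "y = to_ac \<xi>" using frobenius_fixed_iff by auto
    then show "y \<in> to_ac ` {\<xi>. \<xi> ^ d = 1}"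
      using y by (auto simp: to_ac_power[symmetric] to_ac_1[symmetric] simp del: to_ac_power to_ac_1)
  qed (auto simp: to_ac_power[symmetric] simp del: to_ac_power)
  then have "card (to_ac ` {\<xi>::'k. \<xi> ^ d = 1}) = d"
    using card_nth_roots[OF of_nat_neq_0_closure[OF d], of 1] by simp
  then show ?thesis by (simp add: card_image inj_on_def)
qed

text \<open>Orthogonality on \<open>\<mu>\<^sub>d\<close>.  If \<open>\<phi>\<^sup>m\<close> were trivial on \<open>\<mu>\<^sub>d\<close> without \<open>d\<close> dividing \<open>m\<close>, then composing with the
  power map \<open>\<kappa>\<^sup>\<times> \<rightarrow> \<mu>\<^sub>d\<close> would make \<open>\<phi>\<^sub>d\<^sup>m\<close> trivial.\<close>

lemma sum_mu_char:
  fixes \<phi> :: "'k::{field,finite} \<Rightarrow> qbar"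
  assumes gen: "generates_chars \<phi>" and d: "d dvd CARD('k) - 1"
  shows "(\<Sum>\<xi> | \<xi> ^ d = 1. \<phi> \<xi> powi m) = (if int d dvd m then of_nat d else 0)"
proof -
  have \<phi>: "\<phi> \<in> mult_chars" using gen by (auto simp: generates_chars_def)
  let ?e = "(CARD('k) - 1) div d"
  have e: "CARD('k) - 1 = ?e * d" using d by simp
  have d0: "d > 0" using d card_field_ge_2[where 'k='k] by (cases d) auto
  have mu: "(x ^ ?e) ^ d = 1" if "x \<noteq> 0" for x :: 'k
    unfolding power_mult[symmetric] e[symmetric] by (rule finite_field_power_eq_1[OF that])
  show ?thesis
  proof (cases "int d dvd m")
    case True
    then obtain k where k: "m = int d * k" by blast
    have "\<phi> \<xi> powi m = 1" if "\<xi> ^ d = 1" for \<xi>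
      using that \<phi> by (simp add: k power_int_mult char_power[symmetric])
    then have "(\<Sum>\<xi> | \<xi> ^ d = 1. \<phi> \<xi> powi m) = of_nat (card {\<xi>::'k. \<xi> ^ d = 1})" by simp
    then show ?thesis using True by (simp only: card_roots_of_unity[OF d] if_True)
  next
    case False
    have "\<exists>x. x \<noteq> 0 \<and> \<phi> (x ^ ?e) powi m \<noteq> 1"
    proof (rule ccontr)
      assume "\<not> ?thesis"
      then have "char_part \<phi> d [^]\<^bsub>char_group\<^esub> m = \<one>\<^bsub>char_group\<^esub>"
        using \<phi> by (intro char_eqI) (auto simp: char_part_pow_apply)
      then show False using False char_part_pow_eq_one_iff[OF gen d] by simp
    qed
    then obtain w :: 'k where w: "w ^ d = 1" "\<phi> w powi m \<noteq> 1" using mu by blast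
    have w0: "w \<noteq> 0" using w(1) d0 by (auto simp: zero_power)
    have "(\<Sum>\<xi> | \<xi> ^ d = 1. \<phi> \<xi> powi m) = (\<Sum>\<xi> | \<xi> ^ d = 1. \<phi> (w * \<xi>) powi m)"
      by (rule sum.reindex_bij_witness[of _ "\<lambda>\<xi>. w * \<xi>" "\<lambda>\<xi>. \<xi> / w"])
        (use w w0 in \<open>auto simp: power_mult_distrib power_divide\<close>)
    also have "\<dots> = \<phi> w powi m * (\<Sum>\<xi> | \<xi> ^ d = 1. \<phi> \<xi> powi m)"
      using \<phi> by (simp add: char_mult power_int_mult_distrib sum_distrib_left)
    finally show ?thesis using w(2) False by simp
  qed
qed

text \<open>If \<open>y\<^sup>d = c \<noteq> 0\<close>, then \<open>y\<^sup>q\<^sup>-\<^sup>1\<close> is a power of \<open>c\<close>, so the Frobenius condition depends on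
  \<open>c\<close> and \<open>\<xi>\<close> alone and is met by all \<open>d\<close> roots or by none.\<close>

lemma card_twisted_roots:
  fixes c \<xi> :: "'k::{field,finite}"
  assumes d: "d dvd CARD('k) - 1"
  shows "card {y. y ^ d = to_ac c \<and> y ^ CARD('k) = to_ac \<xi> * y} =
    (if c = 0 then 1 else if c ^ ((CARD('k) - 1) div d) = \<xi> then d else 0)"
proof -
  let ?e = "(CARD('k) - 1) div d"
  have q: "CARD('k) = Suc (d * ?e)" using d card_field_ge_2[where 'k='k] by simp
  have d0: "d > 0" using d card_field_ge_2[where 'k='k] by (cases d) auto
  show ?thesis
  proof (cases "c = 0")
    case True
    then have "{y. y ^ d = to_ac c \<and> y ^ CARD('k) = to_ac \<xi> * y} = {0}"
      using d0 by (auto simp: zero_power)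
    then show ?thesis using True by simp
  next
    case False
    have "y ^ CARD('k) = to_ac \<xi> * y \<longleftrightarrow> c ^ ?e = \<xi>" if y: "y ^ d = to_ac c" for y
    proof -
      have y0: "y \<noteq> 0" using y False d0 by (auto simp: zero_power)
      have "y ^ CARD('k) = y * (y ^ d) ^ ?e" by (subst q) (simp only: power_Suc power_mult)
      also have "\<dots> = to_ac (c ^ ?e) * y" by (simp add: y)
      finally show ?thesis using y0 by (simp del: to_ac_power)
    qed
    then have "{y. y ^ d = to_ac c \<and> y ^ CARD('k) = to_ac \<xi> * y} =
        (if c ^ ?e = \<xi> then {y. y ^ d = to_ac c} else {})" by auto
    then show ?thesis
      using card_nth_roots[OF of_nat_neq_0_closure[OF d], of "to_ac c"] False by simp
  qed
qed

lemma card_twisted_points: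
  fixes f :: "(nat \<Rightarrow> 'k::{field,finite}) \<Rightarrow> 'k" and V :: "'k point set"
  assumes d: "d dvd CARD('k) - 1"
    and V: "\<And>x y. (x, y) \<in> V \<longleftrightarrow> x \<in> {1..n} \<rightarrow>\<^sub>E UNIV \<and> y ^ d = F x"
    and F: "\<And>x. x \<in> {1..n} \<rightarrow>\<^sub>E UNIV \<Longrightarrow> F (\<lambda>i\<in>{1..n}. to_ac (x i)) = to_ac (f x)"
  shows "card {p \<in> V. frob n p = mu_act \<xi> p} = (\<Sum>x\<in>{1..n} \<rightarrow>\<^sub>E UNIV.
     if f x = 0 then 1 else if f x ^ ((CARD('k) - 1) div d) = \<xi> then d else 0)"
proof -
  let ?X = "{1..n} \<rightarrow>\<^sub>E (UNIV :: 'k set)"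
  let ?Y = "\<lambda>x. {y. y ^ d = to_ac (f x) \<and> y ^ CARD('k) = to_ac \<xi> * y}"
  let ?h = "\<lambda>x::nat \<Rightarrow> 'k. \<lambda>i\<in>{1..n}. to_ac (x i)"
  have d0: "d > 0" using d card_field_ge_2[where 'k='k] by (cases d) auto
  have inj: "inj_on ?h ?X"
  proof (rule inj_onI)
    fix x x' assume x: "x \<in> ?X" "x' \<in> ?X" "?h x = ?h x'"
    show "x = x'"
    proof (rule extensionalityI[of _ "{1..n}"])
      fix i assume "i \<in> {1..n}"
      then show "x i = x' i" using fun_cong[OF x(3), of i] by simp
    qed (use x in \<open>auto simp: PiE_iff\<close>)
  qed
  have "{p \<in> V. frob n p = mu_act \<xi> p} = (\<lambda>(x, y). (?h x, y)) ` (SIGMA x:?X. ?Y x)"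
  proof (intro equalityI subsetI)
    fix p assume "p \<in> {p \<in> V. frob n p = mu_act \<xi> p}"
    moreover obtain x y where p: "p = (x, y)" by (cases p)
    ultimately have x: "x \<in> {1..n} \<rightarrow>\<^sub>E UNIV" "y ^ d = F x"
      and fx: "(\<lambda>i\<in>{1..n}. x i ^ CARD('k)) = x" and y: "y ^ CARD('k) = to_ac \<xi> * y"
      by (auto simp: V frob_def mu_act_def)
    have "x i \<in> range to_ac" if "i \<in> {1..n}" for i
      using fun_cong[OF fx, of i] that by (simp add: frobenius_fixed_iff[symmetric])
    then have "x = ?h (\<lambda>i\<in>{1..n}. of_ac (x i))"
      using x(1) by (intro extensionalityI[of _ "{1..n}"]) (auto simp: PiE_iff to_ac_of_ac)
    moreover have "(\<lambda>i\<in>{1..n}. of_ac (x i)) \<in> ?X" by simp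
    ultimately obtain x' where x': "x' \<in> ?X" "x = ?h x'" by blast
    then have "y \<in> ?Y x'" using x(2) y F[OF x'(1)] by simp
    then show "p \<in> (\<lambda>(x, y). (?h x, y)) ` (SIGMA x:?X. ?Y x)"
      using p x' by (auto intro!: image_eqI[of _ _ "(x', y)"])
  next
    fix p assume "p \<in> (\<lambda>(x, y). (?h x, y)) ` (SIGMA x:?X. ?Y x)"
    then obtain z where z: "z \<in> (SIGMA x:?X. ?Y x)" "p = (\<lambda>(x, y). (?h x, y)) z" by (rule imageE)
    obtain x y where "z = (x, y)" by (cases z)
    then have p: "p = (?h x, y)" "x \<in> ?X" "y \<in> ?Y x" using z by auto
    have "(\<lambda>i\<in>{1..n}. ?h x i ^ CARD('k)) = ?h x"
      by (rule extensionalityI[of _ "{1..n}"]) (auto simp: frobenius_fixed_iff simp del: to_ac_power)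
    then have "frob n p = mu_act \<xi> p"
      using p(3) unfolding p(1) by (simp only: frob_def mu_act_def split_conv mem_Collect_eq)
    moreover have "p \<in> V"
      using p(3) F[OF p(2)] unfolding p(1) V by simp
    ultimately show "p \<in> {p \<in> V. frob n p = mu_act \<xi> p}" by simp
  qed
  moreover have "inj_on (\<lambda>(x, y). (?h x, y)) (SIGMA x:?X. ?Y x)"
  proof (rule inj_onI)
    fix z w assume zw: "z \<in> (SIGMA x:?X. ?Y x)" "w \<in> (SIGMA x:?X. ?Y x)"
      "(\<lambda>(x, y). (?h x, y)) z = (\<lambda>(x, y). (?h x, y)) w"
    obtain x y x' y' where eq: "z = (x, y)" "w = (x', y')" by (cases z; cases w)
    have "?h x = ?h x'" "y = y'" using zw(3) unfolding eq by (simp_all only: split_conv prod.inject)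
    moreover have "x \<in> ?X" "x' \<in> ?X" using zw(1,2) unfolding eq by blast+
    ultimately show "z = w" using inj_onD[OF inj] unfolding eq by blast
  qed
  ultimately have "card {p \<in> V. frob n p = mu_act \<xi> p} = card (SIGMA x:?X. ?Y x)"
    by (simp only: card_image)
  also have "\<dots> = (\<Sum>x\<in>?X. card (?Y x))"
    using d0 by (intro card_SigmaI ballI finite_PiE)
      (auto intro: finite_subset[OF _ card_power_eq_le(1)[OF d0]])
  finally show ?thesis by (simp only: card_twisted_roots[OF d])
qed

text \<open>A point with \<open>f(x) = 0\<close> is counted once for every \<open>\<xi>\<close>, so it contributes the average of
  \<open>\<chi>\<^sup>m\<close> over \<open>\<mu>\<^sub>d\<close>.\<close>

lemma mu_count_cyclic_cover:
  fixes \<phi> :: "'k::{field,finite} \<Rightarrow> qbar" and f :: "(nat \<Rightarrow> 'k) \<Rightarrow> 'k" and V :: "'k point set"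
  assumes gen: "generates_chars \<phi>" and d: "d dvd CARD('k) - 1"
    and V: "\<And>x y. (x, y) \<in> V \<longleftrightarrow> x \<in> {1..n} \<rightarrow>\<^sub>E UNIV \<and> y ^ d = F x"
    and F: "\<And>x. x \<in> {1..n} \<rightarrow>\<^sub>E UNIV \<Longrightarrow> F (\<lambda>i\<in>{1..n}. to_ac (x i)) = to_ac (f x)"
  shows "mu_count n d 1 V (mu_char_power \<phi> d m) = (if int d dvd m then of_nat CARD('k) ^ n
     else \<Sum>x\<in>{1..n} \<rightarrow>\<^sub>E UNIV. (char_part \<phi> d [^]\<^bsub>char_group\<^esub> m) (f x))"
proof -
  let ?X = "{1..n} \<rightarrow>\<^sub>E (UNIV :: 'k set)"
  let ?e = "(CARD('k) - 1) div d"
  let ?\<eta> = "char_part \<phi> d [^]\<^bsub>char_group\<^esub> m"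
  let ?U = "{\<xi>::'k. \<xi> ^ d = 1}"
  have \<phi>: "\<phi> \<in> mult_chars" using gen by (auto simp: generates_chars_def)
  have d0: "d > 0" using d card_field_ge_2[where 'k='k] by (cases d) auto
  have e: "CARD('k) - 1 = ?e * d" using d by simp
  have mu: "x ^ ?e \<in> ?U" if "x \<noteq> 0" for x :: 'k
    unfolding mem_Collect_eq power_mult[symmetric] e[symmetric] by (rule finite_field_power_eq_1[OF that])
  have theta: "mu_char_power \<phi> d m \<xi> = \<phi> \<xi> powi m" if "\<xi> \<in> ?U" for \<xi>
    using that by (simp add: mu_char_power_def mu_char_def roots_of_unity_def)
  have inner: "(\<Sum>\<xi>\<in>?U. \<phi> \<xi> powi m * of_nat (if f x = 0 then 1 else if f x ^ ?e = \<xi> then d else 0)) =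
      of_nat d * (if f x = 0 then (if int d dvd m then 1 else 0) else ?\<eta> (f x))" for x
  proof (cases "f x = 0")
    case True
    then show ?thesis using sum_mu_char[OF gen d, of m] by simp
  next
    case False
    have "(\<Sum>\<xi>\<in>?U. \<phi> \<xi> powi m * of_nat (if f x = 0 then 1 else if f x ^ ?e = \<xi> then d else 0)) =
        (\<Sum>\<xi>\<in>?U. if \<xi> = f x ^ ?e then of_nat d * \<phi> \<xi> powi m else 0)"
      using False by (intro sum.cong) auto
    also have "\<dots> = of_nat d * \<phi> (f x ^ ?e) powi m"
      using mu[OF False] by (subst sum.delta) simp_all
    finally show ?thesis using False \<phi> by (simp add: char_part_pow_apply)
  qed
  have "mu_count n d 1 V (mu_char_power \<phi> d m) =
      1 / of_nat d * (\<Sum>\<xi>\<in>?U. mu_char_power \<phi> d m \<xi> * of_nat (card {p \<in> V. frob n p = mu_act \<xi> p}))"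
    by (simp add: mu_count_def point_count_def roots_of_unity_def card_roots_of_unity[OF d])
  also have "\<dots> = 1 / of_nat d * (\<Sum>\<xi>\<in>?U. \<phi> \<xi> powi m *
      of_nat (\<Sum>x\<in>?X. if f x = 0 then 1 else if f x ^ ?e = \<xi> then d else 0))"
    by (simp only: theta card_twisted_points[OF d V F] cong: sum.cong)
  also have "\<dots> = 1 / of_nat d * (\<Sum>x\<in>?X. \<Sum>\<xi>\<in>?U. \<phi> \<xi> powi m *
      of_nat (if f x = 0 then 1 else if f x ^ ?e = \<xi> then d else 0))"
    by (subst sum.swap) (simp only: of_nat_sum sum_distrib_left[of _ _ ?X])
  also have "\<dots> = (\<Sum>x\<in>?X. if f x = 0 then (if int d dvd m then 1 else 0) else ?\<eta> (f x))"
    unfolding inner sum_distrib_left[symmetric] using d0 by simp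
  finally have count: "mu_count n d 1 V (mu_char_power \<phi> d m) = \<dots>" .
  show ?thesis
  proof (cases "int d dvd m")
    case True
    then have "?\<eta> = \<one>\<^bsub>char_group\<^esub>" using char_part_pow_eq_one_iff[OF gen d] by simp
    then have "mu_count n d 1 V (mu_char_power \<phi> d m) = (\<Sum>x\<in>?X. 1)"
      unfolding count using True by (intro sum.cong) auto
    then show ?thesis using True by (simp add: card_PiE)
  next
    case False
    then have "(if f x = 0 then (if int d dvd m then 1 else 0) else ?\<eta> (f x)) = ?\<eta> (f x)" for x
      using \<phi> by simp
    then show ?thesis unfolding count if_not_P[OF False] by (simp only:)
  qed
qed

section \<open>The two hypersurfaces\<close>

lemma finprod_int_pow:
  assumes "\<chi> \<in> mult_chars" "finite I"
  shows "(\<Otimes>\<^bsub>char_group\<^esub>i\<in>I. \<chi> [^]\<^bsub>char_group\<^esub> (m * int (s i))) =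
    \<chi> [^]\<^bsub>char_group\<^esub> (m * int (\<Sum>i\<in>I. s i))"
  using assms(2)
proof (induction I)
  case (insert i I)
  then show ?case
    using assms(1) chars.int_pow_mult[of \<chi> "m * int (s i)" "m * int (\<Sum>i\<in>I. s i)"]
    by (simp add: Pi_iff distrib_left)
qed simp

theorem theorem4p8:
  fixes \<psi> \<phi> :: "'k::{field,finite} \<Rightarrow> qbar"
    and n d a :: nat and b c :: "nat \<Rightarrow> nat"
    and l :: "nat \<Rightarrow> 'k" and m :: int
  assumes "nontrivial_add_char \<psi>"
    and "generates_chars \<phi>"
    and "n \<ge> 1" and "d > 0" and "a > 0"
    and "\<forall>i\<in>{1..n}. b i > 0" and "\<forall>i\<in>{1..n}. c i > 0"
    and "d dvd CARD('k) - 1"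
    and "\<forall>i\<in>{1..n}. l i \<noteq> 0"
  shows
    "(gcd d a = 1 \<and> (\<forall>i\<in>{1..n}. gcd d (c i) = 1) \<longrightarrow>
       mu_count n d 1 (S1_A n d a b c l) (mu_char_power \<phi> d m) =
         (if int d dvd m then of_nat CARD('k) ^ n
          else
            (\<Prod>i\<in>{1..n}. - jacobi [char_part \<phi> d [^]\<^bsub>char_group\<^esub> (m * int (b i)),
                                  char_part \<phi> d [^]\<^bsub>char_group\<^esub> (m * int (c i))]) *
            lauricella_A \<psi> n
              ((inv\<^bsub>char_group\<^esub> (char_part \<phi> d)) [^]\<^bsub>char_group\<^esub> (m * int a))
              (\<lambda>i. char_part \<phi> d [^]\<^bsub>char_group\<^esub> (m * int (b i)))
              (\<lambda>i. char_part \<phi> d [^]\<^bsub>char_group\<^esub> (m * int (b i + c i)))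
              l)) \<and>
     (gcd d a = 1 \<and> (\<forall>i\<in>{1..n}. gcd d (b i) = 1) \<longrightarrow>
       mu_count n d 1 (S2_A n d a b c l) (mu_char_power \<phi> d m) =
         (if int d dvd m then of_nat CARD('k) ^ n
          else
            (-1) ^ n *
            jacobi (char_part \<phi> d [^]\<^bsub>char_group\<^esub> (m * int a) #
                    map (\<lambda>i. char_part \<phi> d [^]\<^bsub>char_group\<^esub> (m * int (b i + c i))) [1..<Suc n]) *
            lauricella_A \<psi> n
              ((inv\<^bsub>char_group\<^esub> (char_part \<phi> d)) [^]\<^bsub>char_group\<^esub>
                 (m * int (a + (\<Sum>i\<in>{1..n}. b i + c i))))
              (\<lambda>i. (inv\<^bsub>char_group\<^esub> (char_part \<phi> d)) [^]\<^bsub>char_group\<^esub> (m * int (b i)))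
              (\<lambda>i. (inv\<^bsub>char_group\<^esub> (char_part \<phi> d)) [^]\<^bsub>char_group\<^esub> (m * int (b i + c i)))
              l))"
proof -
  let ?\<chi> = "char_part \<phi> d"
  define p where "p k = ?\<chi> [^]\<^bsub>char_group\<^esub> (m * int k)" for k
  let ?\<eta> = "?\<chi> [^]\<^bsub>char_group\<^esub> m"
  have \<phi>: "\<phi> \<in> mult_chars" using assms(2) by (auto simp: generates_chars_def)
  then have \<chi>: "?\<chi> \<in> mult_chars" by simp
  then have p: "p k \<in> mult_chars" for k by (simp add: p_def)
  \<comment> \<open>For \<open>k = 0\<close> the two sides differ at \<open>x = 0\<close>; this is why the exponents are positive.\<close>
  have p_apply: "p k x = ?\<eta> x ^ k" if "k > 0" for k x
  proof -
    have "p k = ?\<eta> [^]\<^bsub>char_group\<^esub> k"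
      unfolding p_def using chars.int_pow_pow[of ?\<chi> m "int k"] \<chi> by (simp add: int_pow_int)
    then show ?thesis using \<chi> that by (simp add: char_nat_pow_apply)
  qed
  have p_add: "p (j + k) = p j \<otimes>\<^bsub>char_group\<^esub> p k" for j k
    using chars.int_pow_mult[of ?\<chi>] \<chi> by (simp add: p_def distrib_left)
  have p_neq: "p k \<noteq> \<one>\<^bsub>char_group\<^esub>" if "\<not> int d dvd m" "gcd d k = 1" for k
  proof -
    have "coprime (int d) (int k)" using that(2) by (simp add: coprime_iff_gcd_eq_1)
    then show ?thesis using that(1) unfolding p_def
      by (simp add: char_part_pow_eq_one_iff[OF assms(2,8)] coprime_dvd_mult_left_iff)
  qed
  have p_sum: "p (\<Sum>i\<in>{1..n}. s i) = (\<Otimes>\<^bsub>char_group\<^esub>i\<in>{1..n}. p (s i))" for s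
    unfolding p_def by (rule finprod_int_pow[symmetric]) (use \<chi> in auto)
  have inv_p: "(inv\<^bsub>char_group\<^esub> ?\<chi>) [^]\<^bsub>char_group\<^esub> (m * int k) = inv\<^bsub>char_group\<^esub> (p k)" for k
    using chars.int_pow_inv[of ?\<chi>] \<chi> by (simp add: p_def)
  let ?f1 = "\<lambda>x. (1 - (\<Sum>i\<in>{1..n}. l i * x i)) ^ a * (\<Prod>i\<in>{1..n}. x i ^ b i * (1 - x i) ^ c i)"
  let ?f2 = "\<lambda>x. (\<Prod>i\<in>{1..n}. (x i - l i) ^ b i) * (\<Prod>i\<in>{1..n}. x i ^ c i) * (1 - (\<Sum>i\<in>{1..n}. x i)) ^ a"
  have \<eta>: "?\<eta> \<in> mult_chars" using \<chi> by simp
  have f1: "?\<eta> (?f1 x) = p a (1 - (\<Sum>i\<in>{1..n}. l i * x i)) *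
      (\<Prod>i\<in>{1..n}. p (b i) (x i) * p (c i) (1 - x i))" for x
    using assms(5-7) by (simp add: char_mult[OF \<eta>] char_power[OF \<eta>] char_prod[OF \<eta>] p_apply)
  have f2: "?\<eta> (?f2 x) = p a (1 - (\<Sum>i\<in>{1..n}. x i)) *
      (\<Prod>i\<in>{1..n}. p (b i) (x i - l i) * p (c i) (x i))" for x
    using assms(5-7) by (simp add: char_mult[OF \<eta>] char_power[OF \<eta>] char_prod[OF \<eta>] p_apply prod.distrib)
  have count1: "mu_count n d 1 (S1_A n d a b c l) (mu_char_power \<phi> d m) =
    (if int d dvd m then of_nat CARD('k) ^ n else \<Sum>x\<in>{1..n} \<rightarrow>\<^sub>E UNIV. ?\<eta> (?f1 x))"
    by (rule mu_count_cyclic_cover[OF assms(2,8), where F = "\<lambda>x. (1 - (\<Sum>i\<in>{1..n}. to_ac (l i) * x i)) ^ a *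
                (\<Prod>i\<in>{1..n}. x i ^ b i * (1 - x i) ^ c i)"])
      (simp_all add: S1_A_def to_ac_sum to_ac_prod)
  have count2: "mu_count n d 1 (S2_A n d a b c l) (mu_char_power \<phi> d m) =
    (if int d dvd m then of_nat CARD('k) ^ n else \<Sum>x\<in>{1..n} \<rightarrow>\<^sub>E UNIV. ?\<eta> (?f2 x))"
    by (rule mu_count_cyclic_cover[OF assms(2,8), where F = "\<lambda>x. (\<Prod>i\<in>{1..n}. (x i - to_ac (l i)) ^ b i) *
                (\<Prod>i\<in>{1..n}. x i ^ c i) * (1 - (\<Sum>i\<in>{1..n}. x i)) ^ a"])
      (simp_all add: S2_A_def to_ac_sum to_ac_prod)
  show ?thesis
    unfolding count1 count2 f1 f2 inv_p unfolding p_def[symmetric] p_add p_sum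
  proof (intro conjI impI if_cong refl)
    assume "gcd d a = 1 \<and> (\<forall>i\<in>{1..n}. gcd d (c i) = 1)" "\<not> int d dvd m"
    then show "(\<Sum>x\<in>{1..n} \<rightarrow>\<^sub>E UNIV. p a (1 - (\<Sum>i\<in>{1..n}. l i * x i)) *
          (\<Prod>i\<in>{1..n}. p (b i) (x i) * p (c i) (1 - x i))) =
        (\<Prod>i\<in>{1..n}. - jacobi [p (b i), p (c i)]) *
        lauricella_A \<psi> n (inv\<^bsub>char_group\<^esub> (p a)) (\<lambda>i. p (b i))
          (\<lambda>i. p (b i) \<otimes>\<^bsub>char_group\<^esub> p (c i)) l"
      using assms(9) by (intro lauricella_A_integral_cube[OF assms(1)] p p_neq) auto
  next
    assume "gcd d a = 1 \<and> (\<forall>i\<in>{1..n}. gcd d (b i) = 1)" "\<not> int d dvd m"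
    then show "(\<Sum>x\<in>{1..n} \<rightarrow>\<^sub>E UNIV. p a (1 - (\<Sum>i\<in>{1..n}. x i)) *
          (\<Prod>i\<in>{1..n}. p (b i) (x i - l i) * p (c i) (x i))) =
        (-1) ^ n * jacobi (p a # map (\<lambda>i. p (b i) \<otimes>\<^bsub>char_group\<^esub> p (c i)) [1..<Suc n]) *
        lauricella_A \<psi> n
          (inv\<^bsub>char_group\<^esub> (p a \<otimes>\<^bsub>char_group\<^esub> (\<Otimes>\<^bsub>char_group\<^esub>i\<in>{1..n}. p (b i) \<otimes>\<^bsub>char_group\<^esub> p (c i))))
          (\<lambda>i. inv\<^bsub>char_group\<^esub> (p (b i))) (\<lambda>i. inv\<^bsub>char_group\<^esub> (p (b i) \<otimes>\<^bsub>char_group\<^esub> p (c i))) l"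
      using assms(9) by (intro lauricella_A_integral_simplex[OF assms(1)] p p_neq) auto
  qed
qed

end
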